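(* Let $X,E\in\mathbb{R}^{p_1\times p_2}$ and $\hat X=X+E$, with partitioned singular value decompositions $X=U\Sigma V^\top+U_\perp\Sigma_\perp V_\perp^\top$ and $\hat X=\hat U\hat\Sigma\hat V^\top+\hat U_\perp\hat\Sigma_\perp\hat V_\perp^\top$. If $\sigma_r(X)>\sigma_{r+1}(X)\ge0$ and $\sigma_r(X)\ge2\|E\|_2$, then $$\begin{aligned}\|\hat U-UW_U\|_{2\to\infty}&\le2\left(\frac{\|(U_\perp U_\perp^\top)E(VV^\top)\|_{2\to\infty}}{\sigma_r(X)}\right)\\&\quad+2\left(\frac{\|(U_\perp U_\perp^\top)E(V_\perp V_\perp^\top)\|_{2\to\infty}}{\sigma_r(X)}\right)\|\sin\Theta(\hat V,V)\|_2\\&\quad+2\left(\frac{\|(U_\perp U_\perp^\top)X(V_\perp V_\perp^\top)\|_{2\to\infty}}{\sigma_r(X)}\right)\|\sin\Theta(\hat V,V)\|_2\\&\quad+\|\sin\Theta(\hat U,U)\|_2^2\,\|U\|_{2\to\infty}.\end{aligned}$$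
   Context: Here $p_1,p_2,r$ are positive integers with $r\le\min(p_1,p_2)$, and $\sigma_1(M)\ge\sigma_2(M)\ge\cdots\ge0$ denote the singular values of a matrix $M$ (with $\sigma_k(M)=0$ for $k$ exceeding the smaller dimension). $\|\cdot\|_2$ is the spectral norm and $\|A\|_{2\to\infty}:=\sup_{\|x\|_2=1}\|Ax\|_\infty$. In the decomposition of $X$: $U\in\mathbb{R}^{p_1\times r}$ and $V\in\mathbb{R}^{p_2\times r}$ have orthonormal columns, $[U|U_\perp]\in\mathbb{R}^{p_1\times p_1}$ and $[V|V_\perp]\in\mathbb{R}^{p_2\times p_2}$ are orthogonal, $\Sigma=\mathrm{diag}(\sigma_1(X),\dots,\sigma_r(X))$, and $\Sigma_\perp\in\mathbb{R}^{(p_1-r)\times(p_2-r)}$ has the remaining singular values $\sigma_{r+1}(X),\dots$ on its main diagonal and zeros elsewhere. The quantities $\hat U,\hat U_\perp,\hat V,\hat V_\perp,\hat\Sigma,\hat\Sigma_\perp$ are defined analogously for $\hat X$. $W_U$ is the Frobenius-optimal Procrustes matrix: if $U^\top\hat U=W_1\Sigma_UW_2^\top$ is a singular value decomposition of the $r\times r$ matrix $U^\top\hat U$, then $W_U:=W_1W_2^\top$. For matrices $U,\hat U$ of the same size with $r$ orthonormal columns, $\Theta(\hat U,U):=\mathrm{diag}(\cos^{-1}(\sigma_1(U^\top\hat U)),\dots,\cos^{-1}(\sigma_r(U^\top\hat U)))$ is the diagonal matrix of canonical angles, and $\sin\Theta(\hat U,U)$ is obtained by applying $\sin$ to the diagonal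 entries. *)

theory Defs
  imports
    Complex_Main
    "Jordan_Normal_Form.Char_Poly"
begin

text \<open>
  Matrices with explicit carriers are used because blocks such as \<open>U\<^sub>\<bottom>\<close> have
  \<open>p\<^sub>1 - r\<close> columns, a number that may be \<open>0\<close>.
\<close>

definition l2_norm_vec :: "real vec \<Rightarrow> real" where
  "l2_norm_vec x = sqrt (\<Sum>i<dim_vec x. (x $ i)\<^sup>2)"

text \<open>Only meaningful for vectors of positive dimension.\<close>

definition linf_norm_vec :: "real vec \<Rightarrow> real" where
  "linf_norm_vec x = Max {\<bar>x $ i\<bar> | i. i < dim_vec x}"

text \<open>The two operator norms are only meaningful for matrices of positive dimensions.\<close>

definition spectral_norm :: "real mat \<Rightarrow> real" where
  "spectral_norm A =
     (SUP x \<in> {x \<in> carrier_vec (dim_col A). l2_norm_vec x = 1}. l2_norm_vec (A *\<^sub>v x))"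

definition two_inf_norm :: "real mat \<Rightarrow> real" where
  "two_inf_norm A =
     (SUP x \<in> {x \<in> carrier_vec (dim_col A). l2_norm_vec x = 1}. linf_norm_vec (A *\<^sub>v x))"

text \<open>
  The index starts at \<open>1\<close>: \<open>singular_value A k\<close> is the square root of the \<open>k\<close>-th largest
  eigenvalue of \<open>A\<^sup>T A\<close>, eigenvalues being counted with their multiplicity as roots of the
  characteristic polynomial.  It is \<open>0\<close> for \<open>k\<close> beyond the smaller dimension of \<open>A\<close>.
\<close>

definition singular_value :: "real mat \<Rightarrow> nat \<Rightarrow> real" where
  "singular_value A k =
     (if 1 \<le> k \<and> k \<le> min (dim_row A) (dim_col A)
      then sqrt (rev (sorted_list_of_multiset (proots (char_poly (A\<^sup>T * A)))) ! (k - 1))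
      else 0)"

text \<open>
  Orthogonality in the usual sense (orthonormal columns, square); the library's
  \<open>orthogonal_mat\<close> only asks for pairwise orthogonal nonzero columns.
\<close>

definition orthogonal_matrix :: "nat \<Rightarrow> real mat \<Rightarrow> bool" where
  "orthogonal_matrix n Q \<longleftrightarrow> Q \<in> carrier_mat n n \<and> Q\<^sup>T * Q = 1\<^sub>m n \<and> Q * Q\<^sup>T = 1\<^sub>m n"

text \<open>The block matrix \<open>[A | B]\<close>.\<close>

definition append_cols :: "real mat \<Rightarrow> real mat \<Rightarrow> real mat" where
  "append_cols A B = four_block_mat A B (0\<^sub>m 0 (dim_col A)) (0\<^sub>m 0 (dim_col B))"

definition is_svd :: "real mat \<Rightarrow> real mat \<Rightarrow> real mat \<Rightarrow> real mat \<Rightarrow> bool" where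
  "is_svd A W\<^sub>1 S W\<^sub>2 \<longleftrightarrow>
     orthogonal_matrix (dim_row A) W\<^sub>1 \<and>
     orthogonal_matrix (dim_col A) W\<^sub>2 \<and>
     S = mat (dim_row A) (dim_col A) (\<lambda>(i, j). if i = j then singular_value A (i + 1) else 0) \<and>
     A = W\<^sub>1 * S * W\<^sub>2\<^sup>T"

text \<open>
  \<open>A = U S V\<^sup>T + U' S' V'\<^sup>T\<close>, where the unprimed factors carry the \<open>r\<close> largest singular
  values and the primed ones (written with a subscript \<open>\<bottom>\<close> in the literature) the others.
\<close>

definition partitioned_svd ::
  "nat \<Rightarrow> real mat \<Rightarrow> real mat \<Rightarrow> real mat \<Rightarrow> real mat \<Rightarrow> real mat \<Rightarrow> real mat \<Rightarrow> real mat \<Rightarrow> bool"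
where
  "partitioned_svd r A U S V U' S' V' \<longleftrightarrow>
     U \<in> carrier_mat (dim_row A) r \<and> U' \<in> carrier_mat (dim_row A) (dim_row A - r) \<and>
     V \<in> carrier_mat (dim_col A) r \<and> V' \<in> carrier_mat (dim_col A) (dim_col A - r) \<and>
     orthogonal_matrix (dim_row A) (append_cols U U') \<and>
     orthogonal_matrix (dim_col A) (append_cols V V') \<and>
     S = mat_diag r (\<lambda>i. singular_value A (i + 1)) \<and>
     S' = mat (dim_row A - r) (dim_col A - r)
            (\<lambda>(i, j). if i = j then singular_value A (r + i + 1) else 0) \<and>
     A = U * S * V\<^sup>T + U' * S' * V'\<^sup>T"

definition is_procrustes :: "real mat \<Rightarrow> real mat \<Rightarrow> real mat \<Rightarrow> bool" where
  "is_procrustes U U_hat W \<longleftrightarrow> (\<exists>W\<^sub>1 S W\<^sub>2. is_svd (U\<^sup>T * U_hat) W\<^sub>1 S W\<^sub>2 \<and> W = W\<^sub>1 * W\<^sub>2\<^sup>T)"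

text \<open>The number \<open>r\<close> of canonical angles is the number of columns.\<close>

definition canonical_angles :: "real mat \<Rightarrow> real mat \<Rightarrow> real mat" where
  "canonical_angles U_hat U = mat_diag (dim_col U) (\<lambda>i. arccos (singular_value (U\<^sup>T * U_hat) (i + 1)))"

definition sin_Theta :: "real mat \<Rightarrow> real mat \<Rightarrow> real mat" where
  "sin_Theta U_hat U = mat_diag (dim_col U) (\<lambda>i. sin (canonical_angles U_hat U $$ (i, i)))"

end

theory Submission
  imports Defs "HOL-Analysis.L2_Norm"
begin

text \<open>
  Let \<open>P = U\<^sub>p U\<^sub>p\<^sup>T\<close>.  Since \<open>U U\<^sup>T + P = 1\<close>, the error splits as
  \<open>U_hat - U W\<^sub>U = U (U\<^sup>T U_hat - W\<^sub>U) + P U_hat\<close>.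

  In the bases of the singular value decomposition that defines \<open>W\<^sub>U\<close>, the matrix
  \<open>U\<^sup>T U_hat - W\<^sub>U\<close> is diagonal with entries \<open>cos \<theta> - 1\<close> for the canonical angles
  \<open>\<theta>\<close>, and \<open>1 - cos \<theta> \<le> sin\<^sup>2 \<theta>\<close>.  This gives the last term of the bound
  (\<open>procrustes_residual_le\<close>).

  For the other part, \<open>X_hat V_hat = U_hat \<Sigma>_hat\<close>, so
  \<open>P U_hat = P (X + E) V_hat \<Sigma>_hat\<^sup>-\<^sup>1\<close>.  Insert \<open>V V\<^sup>T + V\<^sub>p V\<^sub>p\<^sup>T = 1\<close> in front
  of \<open>V_hat\<close>.  Of the four products that arise, \<open>P X V V\<^sup>T\<close> vanishes, because \<open>X\<close> maps
  the span of \<open>V\<close> into that of \<open>U\<close>.  The other three are the remaining terms of the bound: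
  those that pass through \<open>V\<^sub>p\<close> gain the factor \<open>sin \<Theta>\<close>, which bounds the norm of
  \<open>V\<^sub>p\<^sup>T V_hat\<close> (\<open>complement_overlap_le_sin_Theta\<close>), and the factor
  \<open>2 / \<sigma>\<^sub>r(X)\<close> bounds the norm of \<open>\<Sigma>_hat\<^sup>-\<^sup>1\<close>, because
  \<open>\<sigma>\<^sub>r(X_hat) \<ge> \<sigma>\<^sub>r(X) - \<parallel>E\<parallel>\<^sub>2 \<ge> \<sigma>\<^sub>r(X) / 2\<close> by Weyl's inequality
  (\<open>singular_value_perturbation\<close>).

  Singular values are given as roots of a characteristic polynomial, so they have to be tied to norms.
  All roots of the characteristic polynomial of a real symmetric matrix are real
  (\<open>symmetric_char_poly_splits\<close>), which makes the sorted list of roots long enough for every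
  index that is used, and an eigenvector shows that each singular value is attained.  The matrix
  \<open>V\<^sup>T V_hat\<close> comes without a decomposition; there it is enough that the smallest singular value
  bounds the stretching from below (\<open>last_singular_value_le\<close>), and this needs only one
  eigenvector, at the infimum of the Rayleigh quotient, in place of a full spectral theorem.
\<close>

section \<open>Norms of vectors and matrices\<close>

lemma l2_norm_vec_L2_set: "l2_norm_vec x = L2_set (\<lambda>i. x $ i) {..<dim_vec x}"
  by (simp add: l2_norm_vec_def L2_set_def)

lemma l2_norm_vec_nonneg [simp]: "0 \<le> l2_norm_vec x"
  by (simp add: l2_norm_vec_L2_set)

lemma l2_norm_vec_power2: "(l2_norm_vec x)\<^sup>2 = x \<bullet> x"
  by (simp add: l2_norm_vec_def scalar_prod_def sum_nonneg atLeast0LessThan power2_eq_square)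

lemma l2_norm_vec_eq_0_iff: "x \<in> carrier_vec n \<Longrightarrow> l2_norm_vec x = 0 \<longleftrightarrow> x = 0\<^sub>v n"
  by (auto simp: l2_norm_vec_L2_set L2_set_eq_0_iff)

lemma l2_norm_vec_smult: "l2_norm_vec (c \<cdot>\<^sub>v x) = \<bar>c\<bar> * l2_norm_vec x"
  by (simp add: l2_norm_vec_def power_mult_distrib sum_distrib_left [symmetric] real_sqrt_mult)

lemma l2_norm_vec_triangle:
  assumes "x \<in> carrier_vec n" "y \<in> carrier_vec n"
  shows "l2_norm_vec (x + y) \<le> l2_norm_vec x + l2_norm_vec y"
proof -
  have "l2_norm_vec (x + y) = L2_set (\<lambda>i. x $ i + y $ i) {..<n}"
    using assms by (auto simp: l2_norm_vec_L2_set intro!: L2_set_cong)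
  then show ?thesis
    using L2_set_triangle_ineq [of "\<lambda>i. x $ i" "\<lambda>i. y $ i" "{..<n}"] assms
    by (simp add: l2_norm_vec_L2_set)
qed

lemma abs_scalar_prod_le:
  assumes "x \<in> carrier_vec n" "y \<in> carrier_vec n"
  shows "\<bar>x \<bullet> y\<bar> \<le> l2_norm_vec x * l2_norm_vec y"
proof -
  have "\<bar>x \<bullet> y\<bar> \<le> (\<Sum>i<n. \<bar>x $ i\<bar> * \<bar>y $ i\<bar>)"
    using assms sum_abs [of "\<lambda>i. x $ i * y $ i" "{..<n}"]
    by (simp add: scalar_prod_def atLeast0LessThan abs_mult)
  also have "\<dots> \<le> l2_norm_vec x * l2_norm_vec y"
    using assms L2_set_mult_ineq [of "\<lambda>i. x $ i" "\<lambda>i. y $ i" "{..<n}"]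
    by (simp add: l2_norm_vec_L2_set)
  finally show ?thesis .
qed

lemma abs_vec_index_le_l2_norm_vec: "i < dim_vec x \<Longrightarrow> \<bar>x $ i\<bar> \<le> l2_norm_vec x"
  using member_le_L2_set [of "{..<dim_vec x}" i "\<lambda>i. \<bar>x $ i\<bar>"]
  by (simp add: l2_norm_vec_L2_set L2_set_def)

lemma l2_norm_unit_vec: "i < n \<Longrightarrow> l2_norm_vec (unit_vec n i) = 1"
  by (simp add: l2_norm_vec_def if_distrib [where f = "\<lambda>t. t\<^sup>2"] sum.delta
      unit_vec_def cong: if_cong)

text \<open>
  The suprema in the operator norms say nothing unless they are bounded; this crude bound, the sum
  of the norms of the rows, provides that.
\<close>

lemma ex_l2_norm_mult_mat_vec_le:
  fixes A :: "real mat"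
  obtains C where "0 \<le> C"
    and "\<And>x. x \<in> carrier_vec (dim_col A) \<Longrightarrow> l2_norm_vec (A *\<^sub>v x) \<le> C * l2_norm_vec x"
proof
  let ?C = "\<Sum>i<dim_row A. l2_norm_vec (row A i)"
  show "0 \<le> ?C" by (simp add: sum_nonneg)
  fix x :: "real vec" assume x: "x \<in> carrier_vec (dim_col A)"
  have "l2_norm_vec (A *\<^sub>v x) \<le> (\<Sum>i<dim_row A. \<bar>(A *\<^sub>v x) $ i\<bar>)"
    using L2_set_le_sum_abs [of "\<lambda>i. (A *\<^sub>v x) $ i" "{..<dim_row A}"]
    by (simp add: l2_norm_vec_L2_set)
  also have "\<dots> \<le> (\<Sum>i<dim_row A. l2_norm_vec (row A i) * l2_norm_vec x)"
    using x by (intro sum_mono) (auto intro!: abs_scalar_prod_le [where n = "dim_col A"])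
  finally show "l2_norm_vec (A *\<^sub>v x) \<le> ?C * l2_norm_vec x"
    by (simp add: sum_distrib_right)
qed

lemma normalize_vec:
  assumes "x \<in> carrier_vec n" "x \<noteq> 0\<^sub>v n"
  obtains u where "u \<in> carrier_vec n" "l2_norm_vec u = 1" "x = l2_norm_vec x \<cdot>\<^sub>v u"
proof
  have "l2_norm_vec x \<noteq> 0" using assms l2_norm_vec_eq_0_iff by blast
  then show "l2_norm_vec ((1 / l2_norm_vec x) \<cdot>\<^sub>v x) = 1"
    and "x = l2_norm_vec x \<cdot>\<^sub>v ((1 / l2_norm_vec x) \<cdot>\<^sub>v x)"
    by (simp_all add: l2_norm_vec_smult smult_smult_assoc)
qed (use assms in simp)

lemma l2_norm_mult_mat_vec_le_spectral_norm:
  assumes A: "A \<in> carrier_mat m n" and x: "x \<in> carrier_vec n"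
  shows "l2_norm_vec (A *\<^sub>v x) \<le> spectral_norm A * l2_norm_vec x"
proof (cases "x = 0\<^sub>v n")
  case True
  then have "A *\<^sub>v x = 0\<^sub>v m" using A by auto
  then have "l2_norm_vec (A *\<^sub>v x) = 0" by (simp add: l2_norm_vec_def)
  then show ?thesis using True l2_norm_vec_eq_0_iff [OF x] by simp
next
  case False
  obtain C where C: "\<And>y. y \<in> carrier_vec (dim_col A) \<Longrightarrow> l2_norm_vec (A *\<^sub>v y) \<le> C * l2_norm_vec y"
    using ex_l2_norm_mult_mat_vec_le by blast
  obtain u where u: "u \<in> carrier_vec n" "l2_norm_vec u = 1" "x = l2_norm_vec x \<cdot>\<^sub>v u"
    using normalize_vec [OF x False] .
  have "l2_norm_vec (A *\<^sub>v u) \<le> spectral_norm A"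
    unfolding spectral_norm_def using A u
    by (intro cSUP_upper bdd_aboveI2 [where M = C]) (use C in fastforce)+
  moreover have "l2_norm_vec (A *\<^sub>v x) = l2_norm_vec x * l2_norm_vec (A *\<^sub>v u)"
    by (subst u(3)) (simp add: mult_mat_vec [OF A u(1)] l2_norm_vec_smult)
  ultimately show ?thesis by (simp add: mult.commute mult_left_mono)
qed

lemma abs_mult_mat_vec_index_le_two_inf_norm:
  assumes A: "A \<in> carrier_mat m n" and x: "x \<in> carrier_vec n" and i: "i < m"
  shows "\<bar>(A *\<^sub>v x) $ i\<bar> \<le> two_inf_norm A * l2_norm_vec x"
proof (cases "x = 0\<^sub>v n")
  case True
  then have "A *\<^sub>v x = 0\<^sub>v m" using A by auto
  then show ?thesis using True l2_norm_vec_eq_0_iff [OF x] i by simp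
next
  case False
  obtain C where C: "\<And>y. y \<in> carrier_vec (dim_col A) \<Longrightarrow> l2_norm_vec (A *\<^sub>v y) \<le> C * l2_norm_vec y"
    using ex_l2_norm_mult_mat_vec_le by blast
  obtain u where u: "u \<in> carrier_vec n" "l2_norm_vec u = 1" "x = l2_norm_vec x \<cdot>\<^sub>v u"
    using normalize_vec [OF x False] .
  have linf: "linf_norm_vec y \<le> l2_norm_vec y" if "dim_vec y = m" for y
    unfolding linf_norm_vec_def
    by (subst Max_le_iff) (use that i abs_vec_index_le_l2_norm_vec in auto)
  have "linf_norm_vec (A *\<^sub>v y) \<le> C" if "y \<in> carrier_vec (dim_col A)" "l2_norm_vec y = 1" for y
    using linf [of "A *\<^sub>v y"] C [OF that(1)] that(2) A by simp
  then have "linf_norm_vec (A *\<^sub>v u) \<le> two_inf_norm A"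
    unfolding two_inf_norm_def using A u
    by (intro cSUP_upper bdd_aboveI2 [where M = C]) auto
  moreover have "\<bar>(A *\<^sub>v u) $ i\<bar> \<le> linf_norm_vec (A *\<^sub>v u)"
    unfolding linf_norm_vec_def using A i by (intro Max_ge) (auto intro!: exI [of _ i])
  moreover have "\<bar>(A *\<^sub>v x) $ i\<bar> = l2_norm_vec x * \<bar>(A *\<^sub>v u) $ i\<bar>"
    by (subst u(3)) (use A i in \<open>simp add: mult_mat_vec [OF A u(1)] abs_mult\<close>)
  ultimately show ?thesis by (simp add: mult.commute mult_left_mono)
qed

lemma two_inf_norm_nonneg:
  assumes "A \<in> carrier_mat m n" "0 < m" "0 < n"
  shows "0 \<le> two_inf_norm A"
  using abs_mult_mat_vec_index_le_two_inf_norm [OF assms(1), of "unit_vec n 0" 0] assms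
  by (simp add: l2_norm_unit_vec)

lemma two_inf_norm_le:
  assumes "A \<in> carrier_mat m n" "0 < m" "0 < n"
    and bound: "\<And>x i. x \<in> carrier_vec n \<Longrightarrow> l2_norm_vec x = 1 \<Longrightarrow> i < m \<Longrightarrow> \<bar>(A *\<^sub>v x) $ i\<bar> \<le> c"
  shows "two_inf_norm A \<le> c"
  unfolding two_inf_norm_def
proof (rule cSUP_least)
  show "{x \<in> carrier_vec (dim_col A). l2_norm_vec x = 1} \<noteq> {}"
    using assms l2_norm_unit_vec [of 0 n] by (auto intro!: exI [of _ "unit_vec n 0"])
  fix x assume "x \<in> {x \<in> carrier_vec (dim_col A). l2_norm_vec x = 1}"
  then show "linf_norm_vec (A *\<^sub>v x) \<le> c"
    unfolding linf_norm_vec_def using assms by (subst Max_le_iff) auto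
qed

section \<open>The smallest eigenvalue of a real symmetric matrix\<close>

lemma scalar_prod_self_nonneg: "0 \<le> (x :: real vec) \<bullet> x"
  by (simp flip: l2_norm_vec_power2)

lemma l2_norm_mult_mat_vec_power2:
  assumes A: "A \<in> carrier_mat m n" and x: "x \<in> carrier_vec n"
  shows "(l2_norm_vec (A *\<^sub>v x))\<^sup>2 = x \<bullet> ((A\<^sup>T * A) *\<^sub>v x)"
proof -
  have Ax: "A *\<^sub>v x \<in> carrier_vec m" using A x by simp
  have "x \<bullet> ((A\<^sup>T * A) *\<^sub>v x) = (A\<^sup>T *\<^sub>v (A *\<^sub>v x)) \<bullet> x"
    using A x by (subst comm_scalar_prod [of _ n]) auto
  also have "\<dots> = (A *\<^sub>v x) \<bullet> (A *\<^sub>v x)"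
    using transpose_vec_mult_scalar [OF A x Ax] .
  finally show ?thesis by (simp add: l2_norm_vec_power2)
qed

lemma symmetric_scalar_prod_commute:
  fixes A :: "'a :: comm_semiring_0 mat"
  assumes "A \<in> carrier_mat n n" "A\<^sup>T = A" "x \<in> carrier_vec n" "y \<in> carrier_vec n"
  shows "y \<bullet> (A *\<^sub>v x) = x \<bullet> (A *\<^sub>v y)"
  using transpose_vec_mult_scalar [of A n n x y] comm_scalar_prod [of "A *\<^sub>v y" n x] assms by simp

text \<open>
  The usual discriminant argument: \<open>(t x + y)\<^sup>T B (t x + y)\<close> is a nonnegative quadratic
  polynomial in \<open>t\<close>.
\<close>

lemma psd_Cauchy_Schwarz:
  fixes B :: "real mat"
  assumes B: "B \<in> carrier_mat n n" "B\<^sup>T = B"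
    and psd: "\<And>x. x \<in> carrier_vec n \<Longrightarrow> 0 \<le> x \<bullet> (B *\<^sub>v x)"
    and x: "x \<in> carrier_vec n" and y: "y \<in> carrier_vec n"
  shows "(y \<bullet> (B *\<^sub>v x))\<^sup>2 \<le> (y \<bullet> (B *\<^sub>v y)) * (x \<bullet> (B *\<^sub>v x))"
proof -
  define a b c where "a = y \<bullet> (B *\<^sub>v y)" "b = y \<bullet> (B *\<^sub>v x)" "c = x \<bullet> (B *\<^sub>v x)"
  have [simp]: "B *\<^sub>v x \<in> carrier_vec n" "B *\<^sub>v y \<in> carrier_vec n" using B x y by auto
  have quad: "0 \<le> c * t\<^sup>2 + 2 * b * t + a" for t
  proof -
    have "0 \<le> (t \<cdot>\<^sub>v x + y) \<bullet> (B *\<^sub>v (t \<cdot>\<^sub>v x + y))" using x y by (intro psd) simp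
    also have "B *\<^sub>v (t \<cdot>\<^sub>v x + y) = t \<cdot>\<^sub>v (B *\<^sub>v x) + B *\<^sub>v y"
      using B x y by (simp add: mult_add_distrib_mat_vec mult_mat_vec)
    also have "(t \<cdot>\<^sub>v x + y) \<bullet> (t \<cdot>\<^sub>v (B *\<^sub>v x) + B *\<^sub>v y) = c * t\<^sup>2 + 2 * b * t + a"
      using x y symmetric_scalar_prod_commute [OF B x y]
      by (simp add: add_scalar_prod_distrib [where n = n] scalar_prod_add_distrib [where n = n]
          a_b_c_def power2_eq_square algebra_simps)
    finally show ?thesis .
  qed
  have c: "0 \<le> c" using psd x by (simp add: a_b_c_def)
  have "b\<^sup>2 \<le> a * c"
  proof (cases "c = 0")
    case True
    have "b = 0"
    proof (rule ccontr)
      assume "b \<noteq> 0"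
      \<comment> \<open>With \<open>c = 0\<close> the polynomial is linear; at this point it takes the value \<open>-1\<close>.\<close>
      then show False using quad [of "- (a + 1) / (2 * b)"] True by simp
    qed
    then show ?thesis using True by simp
  next
    case False
    \<comment> \<open>The minimum of the parabola, at \<open>t = - b / c\<close>.\<close>
    have "0 \<le> c * (c * (- b / c)\<^sup>2 + 2 * b * (- b / c) + a)"
      using c quad [of "- b / c"] by (rule mult_nonneg_nonneg)
    also have "\<dots> = a * c - b\<^sup>2" using False by (simp add: power2_eq_square field_simps)
    finally show ?thesis by simp
  qed
  then show ?thesis by (simp add: a_b_c_def)
qed

lemma det_nonzero_lower_bound:
  fixes B :: "real mat"
  assumes B: "B \<in> carrier_mat n n" and "det B \<noteq> 0"
  obtains c where "0 < c" "\<And>x. x \<in> carrier_vec n \<Longrightarrow> c * l2_norm_vec x \<le> l2_norm_vec (B *\<^sub>v x)"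
proof -
  obtain D where D: "D \<in> carrier_mat n n" "D * B = 1\<^sub>m n"
    using det_non_zero_imp_unit [OF assms, of "()"] unfolding Units_def ring_mat_simps by auto
  obtain C where C: "0 \<le> C"
    "\<And>x. x \<in> carrier_vec (dim_col D) \<Longrightarrow> l2_norm_vec (D *\<^sub>v x) \<le> C * l2_norm_vec x"
    using ex_l2_norm_mult_mat_vec_le [of D] by blast
  show ?thesis
  proof
    \<comment> \<open>\<open>C\<close> bounds an inverse of \<open>B\<close> and may be \<open>0\<close> in dimension \<open>0\<close>, hence \<open>C + 1\<close>.\<close>
    show "0 < 1 / (C + 1)" using C(1) by simp
    fix x :: "real vec" assume x: "x \<in> carrier_vec n"
    then have "x = D *\<^sub>v (B *\<^sub>v x)" using B D by (simp flip: assoc_mult_mat_vec)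
    then have "l2_norm_vec x \<le> C * l2_norm_vec (B *\<^sub>v x)"
      using C(2) [of "B *\<^sub>v x"] B D x by simp
    also have "\<dots> \<le> (C + 1) * l2_norm_vec (B *\<^sub>v x)" by (simp add: mult_right_mono)
    finally show "1 / (C + 1) * l2_norm_vec x \<le> l2_norm_vec (B *\<^sub>v x)"
      using C(1) by (simp add: field_simps)
  qed
qed

text \<open>
  An invertible positive semidefinite form is bounded away from zero on the unit sphere.  With
  \<open>y = B x\<close>, Cauchy-Schwarz for the form gives
  \<open>\<bar>y\<bar>\<^sup>4 \<le> (y\<^sup>T B y) (x\<^sup>T B x) \<le> \<parallel>B\<parallel> \<bar>y\<bar>\<^sup>2 (x\<^sup>T B x)\<close>, and \<open>\<bar>y\<bar>\<close> is at
  least a positive multiple of \<open>\<bar>x\<bar>\<close>.  This replaces the compactness of the sphere.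
\<close>

lemma psd_det_nonzero_lower_bound:
  fixes B :: "real mat"
  assumes B: "B \<in> carrier_mat n n" "B\<^sup>T = B" and "det B \<noteq> 0"
    and psd: "\<And>x. x \<in> carrier_vec n \<Longrightarrow> 0 \<le> x \<bullet> (B *\<^sub>v x)"
  obtains c where "0 < c" "\<And>x. x \<in> carrier_vec n \<Longrightarrow> c * (x \<bullet> x) \<le> x \<bullet> (B *\<^sub>v x)"
proof -
  obtain d where d: "0 < d" "\<And>x. x \<in> carrier_vec n \<Longrightarrow> d * l2_norm_vec x \<le> l2_norm_vec (B *\<^sub>v x)"
    using det_nonzero_lower_bound [OF B(1) \<open>det B \<noteq> 0\<close>] by blast
  obtain C where C: "0 \<le> C"
    "\<And>x. x \<in> carrier_vec (dim_col B) \<Longrightarrow> l2_norm_vec (B *\<^sub>v x) \<le> C * l2_norm_vec x"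
    using ex_l2_norm_mult_mat_vec_le [of B] by blast
  show ?thesis
  proof
    show "0 < d\<^sup>2 / (C + 1)" using d C by simp
    fix x :: "real vec" assume x: "x \<in> carrier_vec n"
    define y where "y = B *\<^sub>v x"
    have y: "y \<in> carrier_vec n" using B x by (simp add: y_def)
    have "(y \<bullet> y) * (y \<bullet> y) = (y \<bullet> (B *\<^sub>v x))\<^sup>2" by (simp add: y_def power2_eq_square)
    also have "\<dots> \<le> (y \<bullet> (B *\<^sub>v y)) * (x \<bullet> (B *\<^sub>v x))"
      using psd_Cauchy_Schwarz [OF B psd x y] .
    also have "\<dots> \<le> ((C + 1) * (y \<bullet> y)) * (x \<bullet> (B *\<^sub>v x))"
    proof (rule mult_right_mono [OF _ psd [OF x]])
      have "y \<bullet> (B *\<^sub>v y) \<le> l2_norm_vec y * l2_norm_vec (B *\<^sub>v y)"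
        using abs_scalar_prod_le [of y n "B *\<^sub>v y"] B y by simp
      also have "\<dots> \<le> l2_norm_vec y * ((C + 1) * l2_norm_vec y)"
        using C(2) [of y] B y by (intro mult_left_mono) (auto simp: algebra_simps intro: add_increasing)
      finally show "y \<bullet> (B *\<^sub>v y) \<le> (C + 1) * (y \<bullet> y)"
        by (simp add: power2_eq_square algebra_simps flip: l2_norm_vec_power2)
    qed
    finally have *: "(y \<bullet> y) * (y \<bullet> y) \<le> (y \<bullet> y) * ((C + 1) * (x \<bullet> (B *\<^sub>v x)))"
      by (simp add: algebra_simps)
    have "y \<bullet> y \<le> (C + 1) * (x \<bullet> (B *\<^sub>v x))"
    proof (cases "y \<bullet> y = 0")
      case True
      then show ?thesis using C psd [OF x] by simp
    next
      case False
      then have "0 < y \<bullet> y" using scalar_prod_self_nonneg [of y] by linarith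
      then show ?thesis using * by (rule mult_left_le_imp_le [rotated])
    qed
    moreover have "d\<^sup>2 * (x \<bullet> x) \<le> y \<bullet> y"
      using power_mono [OF d(2) [OF x], of 2] d(1)
      by (simp add: power_mult_distrib l2_norm_vec_power2 y_def)
    ultimately show "d\<^sup>2 / (C + 1) * (x \<bullet> x) \<le> x \<bullet> (B *\<^sub>v x)"
      using C(1) by (simp add: field_simps)
  qed
qed

text \<open>
  The eigenvalue is the infimum \<open>m\<close> of \<open>x\<^sup>T A x\<close> over unit vectors.  The matrix
  \<open>A - m 1\<close> is positive semidefinite; were it invertible, its form would be at least some
  \<open>c > 0\<close> on unit vectors, and \<open>m + c\<close> would still be a lower bound.
\<close>

lemma ex_eigenvalue_le_Rayleigh:
  fixes A :: "real mat"
  assumes A: "A \<in> carrier_mat n n" "A\<^sup>T = A" and "0 < n"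
  obtains m where "eigenvalue A m" "\<And>x. x \<in> carrier_vec n \<Longrightarrow> m * (x \<bullet> x) \<le> x \<bullet> (A *\<^sub>v x)"
proof -
  define S where "S = {x \<in> carrier_vec n. l2_norm_vec (x :: real vec) = 1}"
  define m where "m = (INF x \<in> S. x \<bullet> (A *\<^sub>v x))"
  obtain C where C: "\<And>x. x \<in> carrier_vec (dim_col A) \<Longrightarrow> l2_norm_vec (A *\<^sub>v x) \<le> C * l2_norm_vec x"
    using ex_l2_norm_mult_mat_vec_le [of A] by blast
  have "bdd_below ((\<lambda>x. x \<bullet> (A *\<^sub>v x)) ` S)"
  proof (rule bdd_belowI2)
    fix x assume "x \<in> S"
    then show "- C \<le> x \<bullet> (A *\<^sub>v x)"
      using abs_scalar_prod_le [of x n "A *\<^sub>v x"] C [of x] A by (simp add: S_def)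
  qed
  then have m_le: "m \<le> x \<bullet> (A *\<^sub>v x)" if "x \<in> S" for x
    unfolding m_def using that by (rule cINF_lower)
  have bound: "m * (x \<bullet> x) \<le> x \<bullet> (A *\<^sub>v x)" if x: "x \<in> carrier_vec n" for x
  proof (cases "x = 0\<^sub>v n")
    case True
    then show ?thesis using A by simp
  next
    case False
    obtain u where u: "u \<in> carrier_vec n" "l2_norm_vec u = 1" and xu: "x = l2_norm_vec x \<cdot>\<^sub>v u"
      using normalize_vec [OF x False] .
    have "x \<bullet> (A *\<^sub>v x) = (l2_norm_vec x)\<^sup>2 * (u \<bullet> (A *\<^sub>v u))"
      by (subst (1 2) xu) (use A u in \<open>simp add: mult_mat_vec [OF A(1)] power2_eq_square\<close>)
    also have "\<dots> \<ge> (l2_norm_vec x)\<^sup>2 * m"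
      using u m_le by (intro mult_left_mono) (auto simp: S_def)
    finally show ?thesis by (simp add: l2_norm_vec_power2 mult.commute)
  qed
  define B where "B = A - m \<cdot>\<^sub>m 1\<^sub>m n"
  have B: "B \<in> carrier_mat n n" "B\<^sup>T = B"
    using A by (auto simp: B_def transpose_minus intro!: eq_matI)
  have Bx: "B *\<^sub>v x = A *\<^sub>v x - m \<cdot>\<^sub>v x" if "x \<in> carrier_vec n" for x
  proof -
    have "(m \<cdot>\<^sub>m 1\<^sub>m n) *\<^sub>v x = m \<cdot>\<^sub>v x"
      using that by (intro eq_vecI) (simp_all add: row_smult)
    then show ?thesis
      using A that by (simp add: B_def minus_mult_distrib_mat_vec [where nr = n and nc = n])
  qed
  have xBx: "x \<bullet> (B *\<^sub>v x) = x \<bullet> (A *\<^sub>v x) - m * (x \<bullet> x)" if "x \<in> carrier_vec n" for x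
    using A that by (simp add: Bx scalar_prod_minus_distrib [where n = n])
  have "det B = 0"
  proof (rule ccontr)
    assume "det B \<noteq> 0"
    then obtain c where c: "0 < c" "\<And>x. x \<in> carrier_vec n \<Longrightarrow> c * (x \<bullet> x) \<le> x \<bullet> (B *\<^sub>v x)"
      using psd_det_nonzero_lower_bound [OF B] bound xBx by (metis diff_ge_0_iff_ge)
    have "m + c \<le> m"
      
    proof (subst (2) m_def, rule cINF_greatest)
      show "S \<noteq> {}" using \<open>0 < n\<close> l2_norm_unit_vec [of 0 n] by (force simp: S_def)
      fix x assume "x \<in> S"
      then have "x \<in> carrier_vec n" "x \<bullet> x = 1" by (auto simp: S_def simp flip: l2_norm_vec_power2)
      then show "m + c \<le> x \<bullet> (A *\<^sub>v x)" using c(2) [of x] xBx [of x] by simp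
    qed
    then show False using c(1) by simp
  qed
  then obtain v where v: "v \<in> carrier_vec n" "v \<noteq> 0\<^sub>v n" "B *\<^sub>v v = 0\<^sub>v n"
    using det_0_iff_vec_prod_zero [OF B(1)] by blast
  have "A *\<^sub>v v = m \<cdot>\<^sub>v v"
  proof (rule eq_vecI)
    fix i assume "i < dim_vec (m \<cdot>\<^sub>v v)"
    then show "(A *\<^sub>v v) $ i = (m \<cdot>\<^sub>v v) $ i"
      using arg_cong [OF v(3), of "\<lambda>w. w $ i"] v(1) A by (simp add: Bx)
  qed (use A v in simp)
  then have "eigenvalue A m"
    using v A by (auto simp: eigenvalue_def eigenvector_def)
  then show ?thesis using bound that by blast
qed

section \<open>Singular values\<close>

text \<open>
  Written for the real and imaginary parts \<open>u\<close>, \<open>w\<close> of an eigenvector, the eigenvalue equation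
  and the symmetry \<open>w\<^sup>T A u = u\<^sup>T A w\<close> give \<open>Im a (u\<^sup>T u + w\<^sup>T w) = 0\<close>.
\<close>

lemma symmetric_complex_eigenvalue_real:
  fixes A :: "real mat"
  assumes A: "A \<in> carrier_mat n n" "A\<^sup>T = A"
    and ev: "eigenvalue (map_mat complex_of_real A) a"
  shows "Im a = 0"
proof -
  obtain v where v: "v \<in> carrier_vec n" "v \<noteq> 0\<^sub>v n"
    and Av: "map_mat complex_of_real A *\<^sub>v v = a \<cdot>\<^sub>v v"
    using ev A by (auto simp: eigenvalue_def eigenvector_def)
  define u w where "u = map_vec Re v" and "w = map_vec Im v"
  have uw: "u \<in> carrier_vec n" "w \<in> carrier_vec n" using v by (auto simp: u_def w_def)
  have entry: "(\<Sum>j<n. complex_of_real (A $$ (i, j)) * v $ j) = a * v $ i" if "i < n" for i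
    using arg_cong [OF Av, of "\<lambda>y. y $ i"] that A v
    by (simp add: scalar_prod_def atLeast0LessThan)
  have Au: "A *\<^sub>v u = Re a \<cdot>\<^sub>v u - Im a \<cdot>\<^sub>v w"
  proof (rule eq_vecI)
    fix i assume "i < dim_vec (Re a \<cdot>\<^sub>v u - Im a \<cdot>\<^sub>v w)"
    then have i: "i < n" using uw by simp
    then show "(A *\<^sub>v u) $ i = (Re a \<cdot>\<^sub>v u - Im a \<cdot>\<^sub>v w) $ i"
      using arg_cong [OF entry [OF i], of Re] A v
      by (simp add: scalar_prod_def atLeast0LessThan u_def w_def)
  qed (use A uw in simp)
  have Aw: "A *\<^sub>v w = Re a \<cdot>\<^sub>v w + Im a \<cdot>\<^sub>v u"
  proof (rule eq_vecI)
    fix i assume "i < dim_vec (Re a \<cdot>\<^sub>v w + Im a \<cdot>\<^sub>v u)"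
    then have i: "i < n" using uw by simp
    then show "(A *\<^sub>v w) $ i = (Re a \<cdot>\<^sub>v w + Im a \<cdot>\<^sub>v u) $ i"
      using arg_cong [OF entry [OF i], of Im] A v
      by (simp add: scalar_prod_def atLeast0LessThan u_def w_def)
  qed (use A uw in simp)
  have "w \<bullet> (A *\<^sub>v u) = u \<bullet> (A *\<^sub>v w)"
    using symmetric_scalar_prod_commute [OF A uw] .
  then have "Im a * (u \<bullet> u + w \<bullet> w) = 0"
    unfolding Au Aw using uw comm_scalar_prod [OF uw]
    by (simp add: scalar_prod_add_distrib [where n = n] scalar_prod_minus_distrib [where n = n]
        algebra_simps)
  moreover have "u \<bullet> u + w \<bullet> w \<noteq> 0"
  proof
    assume "u \<bullet> u + w \<bullet> w = 0"
    then have "u \<bullet> u = 0" "w \<bullet> w = 0"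
      using scalar_prod_self_nonneg [of u] scalar_prod_self_nonneg [of w] by linarith+
    then have "u = 0\<^sub>v n" "w = 0\<^sub>v n"
      using uw by (simp_all add: l2_norm_vec_eq_0_iff flip: l2_norm_vec_power2)
    moreover have "Re (v $ i) = u $ i" "Im (v $ i) = w $ i" if "i < n" for i
      using that v by (simp_all add: u_def w_def)
    ultimately have "v $ i = 0" if "i < n" for i
      using that by (simp add: complex_eq_iff)
    then have "v = 0\<^sub>v n" using v by auto
    then show False using v by simp
  qed
  ultimately show ?thesis by simp
qed

lemma symmetric_char_poly_splits:
  fixes A :: "real mat"
  assumes A: "A \<in> carrier_mat n n" "A\<^sup>T = A"
  obtains es where "length es = n" "char_poly A = (\<Prod>e\<leftarrow>es. [:- e, 1:])"
proof -
  let ?A = "map_mat complex_of_real A"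
  have cA: "?A \<in> carrier_mat n n" using A by simp
  obtain as where as: "char_poly ?A = (\<Prod>a\<leftarrow>as. [:- a, 1:])" "length as = n"
    using char_poly_factorized [OF cA] by blast
  have real: "complex_of_real (Re a) = a" if "a \<in> set as" for a
  proof -
    have "poly (char_poly ?A) a = 0"
      using that unfolding as(1) by (induction as) auto
    then have "Im a = 0"
      using symmetric_complex_eigenvalue_real [OF A] eigenvalue_root_char_poly [OF cA] by blast
    then show ?thesis by (simp add: complex_eq_iff)
  qed
  \<comment> \<open>Real and complex characteristic polynomial agree at real points, where the complex factors
      are real.\<close>
  have "poly (char_poly A) x = poly (\<Prod>e\<leftarrow>map Re as. [:- e, 1:]) x" for x
  proof -
    have "complex_of_real (poly (char_poly A) x) = poly (char_poly ?A) (complex_of_real x)"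
      by (simp add: of_real_hom.char_poly_hom [OF A(1)])
    also have "\<dots> = complex_of_real (poly (\<Prod>e\<leftarrow>map Re as. [:- e, 1:]) x)"
      unfolding as(1) using real by (induction as) auto
    finally show ?thesis by (simp only: of_real_eq_iff)
  qed
  then have "char_poly A = (\<Prod>e\<leftarrow>map Re as. [:- e, 1:])"
    by (simp add: poly_eq_poly_eq_iff [symmetric] fun_eq_iff)
  then show ?thesis using that [of "map Re as"] as(2) by simp
qed

lemma transpose_mult_self:
  fixes A :: "real mat"
  shows "(A\<^sup>T * A) \<in> carrier_mat (dim_col A) (dim_col A)" "(A\<^sup>T * A)\<^sup>T = A\<^sup>T * A"
proof -
  show "A\<^sup>T * A \<in> carrier_mat (dim_col A) (dim_col A)" by auto
  show "(A\<^sup>T * A)\<^sup>T = A\<^sup>T * A"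
    by (subst transpose_mult [of "A\<^sup>T" "dim_col A" "dim_row A" A "dim_col A"])
      (simp_all only: transpose_carrier_mat transpose_transpose carrier_matI)
qed

text \<open>
  Entry \<open>k - 1\<close> is the square of the \<open>k\<close>-th singular value, as long as \<open>k\<close> does not
  exceed the smaller dimension; the list has one entry per column.
\<close>

definition squared_singular_values :: "real mat \<Rightarrow> real list" where
  "squared_singular_values A = rev (sorted_list_of_multiset (proots (char_poly (A\<^sup>T * A))))"

lemma proots_char_poly_symmetric:
  fixes A :: "real mat"
  assumes "A \<in> carrier_mat n n" "A\<^sup>T = A"
  shows "size (proots (char_poly A)) = n" "set_mset (proots (char_poly A)) = {e. eigenvalue A e}"
proof -
  obtain es where es: "length es = n" "char_poly A = (\<Prod>e\<leftarrow>es. [:- e, 1:])"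
    using symmetric_char_poly_splits [OF assms] .
  have "proots (\<Prod>e\<leftarrow>es. [:- e, 1:]) = mset es"
  proof (induction es)
    case (Cons e es)
    have "(\<Prod>e\<leftarrow>es. [:- e, 1:]) \<noteq> 0" by (auto simp: prod_list_zero_iff)
    then show ?case using Cons by (simp add: proots_mult del: mult_pCons_left)
  qed simp
  then show "size (proots (char_poly A)) = n" by (simp add: es)
  have "char_poly A \<noteq> 0" using degree_monic_char_poly [OF assms(1)] by auto
  then show "set_mset (proots (char_poly A)) = {e. eigenvalue A e}"
    by (simp add: eigenvalue_root_char_poly [OF assms(1)])
qed

lemma mset_squared_singular_values:
  "mset (squared_singular_values A) = proots (char_poly (A\<^sup>T * A))"
  by (simp add: squared_singular_values_def)

lemma length_squared_singular_values: "length (squared_singular_values A) = dim_col A"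
  using proots_char_poly_symmetric(1) [OF transpose_mult_self [of A]]
  unfolding mset_squared_singular_values [symmetric] size_mset .

lemma set_squared_singular_values: "set (squared_singular_values A) = {e. eigenvalue (A\<^sup>T * A) e}"
  using proots_char_poly_symmetric(2) [OF transpose_mult_self [of A]]
  unfolding mset_squared_singular_values [symmetric] set_mset_mset .

lemma squared_singular_values_antimono:
  assumes "i \<le> j" "j < dim_col A"
  shows "squared_singular_values A ! j \<le> squared_singular_values A ! i"
proof -
  have "sorted (rev (squared_singular_values A))"
    unfolding squared_singular_values_def rev_rev_ident by (rule sorted_sorted_list_of_multiset)
  from sorted_rev_nth_mono [OF this assms(1)] show ?thesis
    using assms(2) unfolding length_squared_singular_values .
qed

lemma squared_singular_value_attained:
  assumes "e \<in> set (squared_singular_values A)"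
  obtains v where "v \<in> carrier_vec (dim_col A)" "l2_norm_vec v = 1" "e = (l2_norm_vec (A *\<^sub>v v))\<^sup>2"
proof -
  obtain x where x: "x \<in> carrier_vec (dim_col A)" "x \<noteq> 0\<^sub>v (dim_col A)"
    and ev: "(A\<^sup>T * A) *\<^sub>v x = e \<cdot>\<^sub>v x"
    using assms unfolding set_squared_singular_values eigenvalue_def eigenvector_def
      mem_Collect_eq index_mult_mat(2) index_transpose_mat(2) by blast
  obtain v where v: "v \<in> carrier_vec (dim_col A)" "l2_norm_vec v = 1" "x = l2_norm_vec x \<cdot>\<^sub>v v"
    using normalize_vec [OF x] .
  have A: "A \<in> carrier_mat (dim_row A) (dim_col A)" by simp
  have "(l2_norm_vec x)\<^sup>2 * (l2_norm_vec (A *\<^sub>v v))\<^sup>2 = (l2_norm_vec (A *\<^sub>v x))\<^sup>2"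
    by (subst (2) v(3)) (simp add: mult_mat_vec [OF A v(1)] l2_norm_vec_smult power_mult_distrib)
  also have "\<dots> = x \<bullet> (e \<cdot>\<^sub>v x)"
    using l2_norm_mult_mat_vec_power2 [OF A x(1)] unfolding ev .
  also have "\<dots> = (l2_norm_vec x)\<^sup>2 * e"
    using x by (simp add: l2_norm_vec_power2)
  finally show ?thesis
    using that [OF v(1,2)] x l2_norm_vec_eq_0_iff [OF x(1)] by simp
qed

lemma singular_value_eq:
  "singular_value A k =
     (if 1 \<le> k \<and> k \<le> min (dim_row A) (dim_col A) then sqrt (squared_singular_values A ! (k - 1)) else 0)"
  by (simp add: singular_value_def squared_singular_values_def)

lemma squared_singular_value_mem:
  "1 \<le> k \<Longrightarrow> k \<le> min (dim_row A) (dim_col A) \<Longrightarrow>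
    squared_singular_values A ! (k - 1) \<in> set (squared_singular_values A)"
  by (intro nth_mem) (auto simp: length_squared_singular_values)

lemma singular_value_attained:
  assumes "1 \<le> k" "k \<le> min (dim_row A) (dim_col A)"
  obtains v where "v \<in> carrier_vec (dim_col A)" "l2_norm_vec v = 1"
    "singular_value A k = l2_norm_vec (A *\<^sub>v v)"
proof -
  obtain v where "v \<in> carrier_vec (dim_col A)" "l2_norm_vec v = 1"
    and "squared_singular_values A ! (k - 1) = (l2_norm_vec (A *\<^sub>v v))\<^sup>2"
    using squared_singular_value_attained [OF squared_singular_value_mem [OF assms]] .
  then show ?thesis using that [of v] assms by (simp add: singular_value_eq)
qed

lemma singular_value_nonneg: "0 \<le> singular_value A k"
proof (cases "1 \<le> k \<and> k \<le> min (dim_row A) (dim_col A)")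
  case True
  then obtain v where "singular_value A k = l2_norm_vec (A *\<^sub>v v)"
    using singular_value_attained [of k A] by blast
  then show ?thesis by simp
next
  case False
  then show ?thesis by (simp only: singular_value_def if_False order.refl)
qed

lemma singular_value_antimono:
  assumes "1 \<le> i" "i \<le> j"
  shows "singular_value A j \<le> singular_value A i"
proof (cases "j \<le> min (dim_row A) (dim_col A)")
  case True
  then show ?thesis
    using assms by (auto simp: singular_value_eq intro!: squared_singular_values_antimono)
next
  case False
  then have "singular_value A j = 0" by (auto simp: singular_value_def)
  then show ?thesis using singular_value_nonneg by simp
qed

text \<open>
  The matrix is square so that the last singular value belongs to the smallest eigenvalue of
  \<open>A\<^sup>T A\<close>, which is at most the eigenvalue below the Rayleigh quotient.
\<close>

lemma last_singular_value_le:
  assumes A: "A \<in> carrier_mat n n" and "0 < n" and x: "x \<in> carrier_vec n"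
  shows "singular_value A n * l2_norm_vec x \<le> l2_norm_vec (A *\<^sub>v x)"
proof -
  have AA: "A\<^sup>T * A \<in> carrier_mat n n" "(A\<^sup>T * A)\<^sup>T = A\<^sup>T * A"
    using A transpose_mult_self [of A] by auto
  obtain m where m: "eigenvalue (A\<^sup>T * A) m"
    and le: "\<And>x. x \<in> carrier_vec n \<Longrightarrow> m * (x \<bullet> x) \<le> x \<bullet> ((A\<^sup>T * A) *\<^sub>v x)"
    using ex_eigenvalue_le_Rayleigh [OF AA \<open>0 < n\<close>] by blast
  have "m \<in> set (squared_singular_values A)" using m by (simp add: set_squared_singular_values)
  then obtain j where j: "j < n" "m = squared_singular_values A ! j"
    using A by (auto simp: in_set_conv_nth length_squared_singular_values)
  have "squared_singular_values A ! (n - 1) \<le> m"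
    using j A by (auto intro: squared_singular_values_antimono)
  moreover have "0 \<le> squared_singular_values A ! (n - 1)"
    using singular_value_nonneg [of A n] A \<open>0 < n\<close> by (simp add: singular_value_eq)
  ultimately have "(singular_value A n)\<^sup>2 \<le> m"
    using A \<open>0 < n\<close> by (simp add: singular_value_eq)
  then have "(singular_value A n * l2_norm_vec x)\<^sup>2 \<le> m * (x \<bullet> x)"
    using scalar_prod_self_nonneg [of x]
    by (simp add: power_mult_distrib l2_norm_vec_power2 mult_right_mono)
  also have "\<dots> \<le> (l2_norm_vec (A *\<^sub>v x))\<^sup>2"
    using le [OF x] by (simp add: l2_norm_mult_mat_vec_power2 [OF A x])
  finally show ?thesis by (rule power2_le_imp_le) simp
qed

section \<open>Isometries, orthogonal splittings and diagonal matrices\<close>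

lemma isometry_l2_norm:
  fixes Q :: "real mat"
  assumes "Q \<in> carrier_mat m n" "Q\<^sup>T * Q = 1\<^sub>m n" "x \<in> carrier_vec n"
  shows "l2_norm_vec (Q *\<^sub>v x) = l2_norm_vec x"
proof -
  have "(l2_norm_vec (Q *\<^sub>v x))\<^sup>2 = (l2_norm_vec x)\<^sup>2"
    unfolding l2_norm_vec_power2 [of x]
    using l2_norm_mult_mat_vec_power2 [OF assms(1,3)]
    unfolding assms(2) one_mult_mat_vec [OF assms(3)] .
  then show ?thesis by simp
qed

lemma append_cols_blocks:
  fixes A B :: "real mat"
  assumes A: "A \<in> carrier_mat p r" and B: "B \<in> carrier_mat p (p - r)" and "r \<le> p"
    and orth: "orthogonal_matrix p (append_cols A B)"
  shows "A\<^sup>T * A = 1\<^sub>m r" "B\<^sup>T * A = 0\<^sub>m (p - r) r" "A\<^sup>T * B = 0\<^sub>m r (p - r)"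
    "B\<^sup>T * B = 1\<^sub>m (p - r)" "A * A\<^sup>T + B * B\<^sup>T = 1\<^sub>m p"
proof -
  define Q where "Q = append_cols A B"
  have Q: "Q \<in> carrier_mat p p" "Q\<^sup>T * Q = 1\<^sub>m p" "Q * Q\<^sup>T = 1\<^sub>m p"
    using orth unfolding orthogonal_matrix_def Q_def by blast+
  have colA: "col Q j = col A j" if "j < r" for j
    using that A B Q(1) \<open>r \<le> p\<close>
    by (intro eq_vecI) (auto simp: Q_def append_cols_def)
  have colB: "col Q (r + j) = col B j" if "j < p - r" for j
    using that A B Q(1) \<open>r \<le> p\<close>
    by (intro eq_vecI) (auto simp: Q_def append_cols_def)
  have dot: "col Q i \<bullet> col Q j = (if i = j then 1 else 0)" if "i < p" "j < p" for i j
    using arg_cong [OF Q(2), of "\<lambda>M. M $$ (i, j)"] that Q(1) by simp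
  have rowQ: "row Q i = row A i @\<^sub>v row B i" if "i < p" for i
    using that A B Q(1) \<open>r \<le> p\<close>
    by (intro eq_vecI) (auto simp: Q_def append_cols_def)
  have dot': "row A i \<bullet> row A j + row B i \<bullet> row B j = (if i = j then 1 else 0)"
    if "i < p" "j < p" for i j
    using arg_cong [OF Q(3), of "\<lambda>M. M $$ (i, j)"] that Q(1) A B
    by (simp add: rowQ scalar_prod_append [where ?n1.0 = r and ?n2.0 = "p - r"])
  show "A\<^sup>T * A = 1\<^sub>m r"
    using A \<open>r \<le> p\<close> by (intro eq_matI) (auto simp: dot simp flip: colA)
  show "B\<^sup>T * A = 0\<^sub>m (p - r) r"
    using A B \<open>r \<le> p\<close> by (intro eq_matI) (auto simp: dot simp flip: colA colB)
  show "A\<^sup>T * B = 0\<^sub>m r (p - r)"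
    using A B \<open>r \<le> p\<close> by (intro eq_matI) (auto simp: dot simp flip: colA colB)
  show "B\<^sup>T * B = 1\<^sub>m (p - r)"
    using A B \<open>r \<le> p\<close> by (intro eq_matI) (auto simp: dot simp flip: colB)
  show "A * A\<^sup>T + B * B\<^sup>T = 1\<^sub>m p"
    using A B by (intro eq_matI) (auto simp: dot')
qed

lemma orthogonal_sum_l2_norm:
  fixes U U' :: "real mat"
  assumes U: "U \<in> carrier_mat p r" "U\<^sup>T * U = 1\<^sub>m r"
    and U': "U' \<in> carrier_mat p q" "U'\<^sup>T * U' = 1\<^sub>m q" and UU': "U\<^sup>T * U' = 0\<^sub>m r q"
    and x: "x \<in> carrier_vec r" and y: "y \<in> carrier_vec q"
  shows "(l2_norm_vec (U *\<^sub>v x + U' *\<^sub>v y))\<^sup>2 = (l2_norm_vec x)\<^sup>2 + (l2_norm_vec y)\<^sup>2"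
proof -
  have Ux: "U *\<^sub>v x \<in> carrier_vec p" and Uy: "U' *\<^sub>v y \<in> carrier_vec p"
    using U U' x y by auto
  have "(U *\<^sub>v x) \<bullet> (U' *\<^sub>v y) = (U\<^sup>T *\<^sub>v (U' *\<^sub>v y)) \<bullet> x"
    using transpose_vec_mult_scalar [OF U(1) x Uy] comm_scalar_prod [OF Ux Uy] by simp
  also have "U\<^sup>T *\<^sub>v (U' *\<^sub>v y) = 0\<^sub>m r q *\<^sub>v y"
    unfolding UU' [symmetric] using U U' y by simp
  also have "0\<^sub>m r q *\<^sub>v y = 0\<^sub>v r" using y by (intro eq_vecI) auto
  finally have "(U *\<^sub>v x) \<bullet> (U' *\<^sub>v y) = 0" using x by simp
  then have "(l2_norm_vec (U *\<^sub>v x + U' *\<^sub>v y))\<^sup>2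
      = (l2_norm_vec (U *\<^sub>v x))\<^sup>2 + (l2_norm_vec (U' *\<^sub>v y))\<^sup>2"
    unfolding l2_norm_vec_power2 using Ux Uy comm_scalar_prod [OF Ux Uy]
    by (simp add: add_scalar_prod_distrib [where n = p] scalar_prod_add_distrib [where n = p])
  then show ?thesis using isometry_l2_norm [OF U x] isometry_l2_norm [OF U' y] by simp
qed

lemma complementary_l2_norm:
  fixes V V' :: "real mat"
  assumes V: "V \<in> carrier_mat p r" and V': "V' \<in> carrier_mat p q"
    and sum: "V * V\<^sup>T + V' * V'\<^sup>T = 1\<^sub>m p" and z: "z \<in> carrier_vec p"
  shows "(l2_norm_vec (V\<^sup>T *\<^sub>v z))\<^sup>2 + (l2_norm_vec (V'\<^sup>T *\<^sub>v z))\<^sup>2 = (l2_norm_vec z)\<^sup>2"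
    "z = (V * V\<^sup>T) *\<^sub>v z + (V' * V'\<^sup>T) *\<^sub>v z"
proof -
  have c: "(V * V\<^sup>T) *\<^sub>v z \<in> carrier_vec p" "(V' * V'\<^sup>T) *\<^sub>v z \<in> carrier_vec p"
    using V V' z by auto
  have "z = 1\<^sub>m p *\<^sub>v z" using z by simp
  also have "\<dots> = (V * V\<^sup>T) *\<^sub>v z + (V' * V'\<^sup>T) *\<^sub>v z"
    unfolding sum [symmetric] by (rule add_mult_distrib_mat_vec [where nr = p and nc = p]) (use V V' z in auto)
  finally show z_eq: "z = (V * V\<^sup>T) *\<^sub>v z + (V' * V'\<^sup>T) *\<^sub>v z" .
  have "(l2_norm_vec (V\<^sup>T *\<^sub>v z))\<^sup>2 = z \<bullet> ((V * V\<^sup>T) *\<^sub>v z)"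
    using l2_norm_mult_mat_vec_power2 [of "V\<^sup>T" r p z] V z unfolding transpose_transpose by simp
  moreover have "(l2_norm_vec (V'\<^sup>T *\<^sub>v z))\<^sup>2 = z \<bullet> ((V' * V'\<^sup>T) *\<^sub>v z)"
    using l2_norm_mult_mat_vec_power2 [of "V'\<^sup>T" q p z] V' z unfolding transpose_transpose by simp
  ultimately have "(l2_norm_vec (V\<^sup>T *\<^sub>v z))\<^sup>2 + (l2_norm_vec (V'\<^sup>T *\<^sub>v z))\<^sup>2
      = z \<bullet> ((V * V\<^sup>T) *\<^sub>v z + (V' * V'\<^sup>T) *\<^sub>v z)"
    using scalar_prod_add_distrib [OF z c] by simp
  then show "(l2_norm_vec (V\<^sup>T *\<^sub>v z))\<^sup>2 + (l2_norm_vec (V'\<^sup>T *\<^sub>v z))\<^sup>2 = (l2_norm_vec z)\<^sup>2"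
    unfolding z_eq [symmetric] l2_norm_vec_power2 .
qed

lemma diag_mult_vec:
  fixes d :: "nat \<Rightarrow> real"
  assumes "w \<in> carrier_vec n"
  shows "mat m n (\<lambda>(i, j). if i = j then d i else 0) *\<^sub>v w
    = vec m (\<lambda>i. if i < n then d i * w $ i else 0)"
  using assms
  by (intro eq_vecI)
    (auto simp: scalar_prod_def if_distrib [where f = "\<lambda>t. t * _"] sum.delta cong: if_cong)

text \<open>
  The bound is asked of the products \<open>d i * w $ i\<close>, not of \<open>d i\<close>, so that a large diagonal
  entry does no harm where \<open>w\<close> vanishes.
\<close>

lemma diag_l2_norm_le:
  assumes w: "w \<in> carrier_vec n" and "0 \<le> c"
    and le: "\<And>i. i < m \<Longrightarrow> i < n \<Longrightarrow> \<bar>d i * w $ i\<bar> \<le> c * \<bar>w $ i\<bar>"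
  shows "l2_norm_vec (mat m n (\<lambda>(i, j). if i = j then d i else 0) *\<^sub>v w) \<le> c * l2_norm_vec w"
    (is "l2_norm_vec (?D *\<^sub>v w) \<le> _")
proof -
  have "(l2_norm_vec (?D *\<^sub>v w))\<^sup>2 = (\<Sum>i<m. (if i < n then d i * w $ i else 0)\<^sup>2)"
    by (simp add: diag_mult_vec [OF w] l2_norm_vec_def sum_nonneg)
  also have "\<dots> = (\<Sum>i<min m n. (d i * w $ i)\<^sup>2)"
    by (rule sum.mono_neutral_cong_right) auto
  also have "\<dots> \<le> (\<Sum>i<min m n. (c * w $ i)\<^sup>2)"
  proof (rule sum_mono)
    fix i assume "i \<in> {..<min m n}"
    then have "\<bar>d i * w $ i\<bar> \<le> \<bar>c * w $ i\<bar>" using le [of i] \<open>0 \<le> c\<close> by (simp add: abs_mult)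
    then show "(d i * w $ i)\<^sup>2 \<le> (c * w $ i)\<^sup>2" by (simp only: abs_le_square_iff)
  qed
  also have "\<dots> \<le> (\<Sum>i<n. (c * w $ i)\<^sup>2)" by (rule sum_mono2) auto
  also have "\<dots> = (c * l2_norm_vec w)\<^sup>2"
    using w by (simp add: l2_norm_vec_def sum_nonneg power_mult_distrib sum_distrib_left)
  finally show ?thesis by (rule power2_le_imp_le) (simp add: \<open>0 \<le> c\<close>)
qed

lemma diag_l2_norm_ge:
  assumes w: "w \<in> carrier_vec n" and ge: "\<And>i. i < n \<Longrightarrow> c \<le> d i" and "0 \<le> c"
  shows "c * l2_norm_vec w \<le> l2_norm_vec (mat n n (\<lambda>(i, j). if i = j then d i else 0) *\<^sub>v w)"
proof (cases "c = 0")
  case False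
  then have c: "0 < c" using \<open>0 \<le> c\<close> by simp
  let ?D = "mat n n (\<lambda>(i, j). if i = j then d i else 0)"
  let ?I = "mat n n (\<lambda>(i, j). if i = j then 1 / d i else 0)"
  have Dw: "?D *\<^sub>v w \<in> carrier_vec n" by (simp add: carrier_vecI)
  have d: "0 < d i" if "i < n" for i using ge [OF that] c by simp
  have "?I *\<^sub>v (?D *\<^sub>v w) = w"
    unfolding diag_mult_vec [OF Dw] using w d [THEN less_imp_neq]
    by (intro eq_vecI) (auto simp: diag_mult_vec [OF w])
  moreover have "l2_norm_vec (?I *\<^sub>v (?D *\<^sub>v w)) \<le> 1 / c * l2_norm_vec (?D *\<^sub>v w)"
  proof (rule diag_l2_norm_le [OF Dw])
    fix i assume "i < n"
    then have "1 / d i \<le> 1 / c" using ge [of i] c by (simp add: frac_le)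
    then show "\<bar>1 / d i * (?D *\<^sub>v w) $ i\<bar> \<le> 1 / c * \<bar>(?D *\<^sub>v w) $ i\<bar>"
      unfolding abs_mult using d [OF \<open>i < n\<close>] by (intro mult_right_mono) auto
  qed (use c in simp)
  ultimately show ?thesis using c by (simp add: field_simps)
qed simp

lemma abs_diag_le_spectral_norm:
  assumes "i < n"
  shows "\<bar>d i\<bar> \<le> spectral_norm (mat_diag n d)"
proof -
  have "mat_diag n d *\<^sub>v unit_vec n i = d i \<cdot>\<^sub>v unit_vec n i"
    unfolding mat_diag_def using assms by (auto simp: diag_mult_vec intro!: eq_vecI)
  then have "l2_norm_vec (mat_diag n d *\<^sub>v unit_vec n i) = \<bar>d i\<bar>"
    using assms by (simp add: l2_norm_vec_smult l2_norm_unit_vec)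
  then show ?thesis
    using l2_norm_mult_mat_vec_le_spectral_norm [of "mat_diag n d" n n "unit_vec n i"] assms
    by (simp add: l2_norm_unit_vec)
qed

text \<open>
  Dimension count: \<open>r - 1\<close> linear equations in \<open>r\<close> unknowns have a nontrivial solution,
  since overwriting the last row of \<open>M\<close> by zeros makes the matrix singular.
\<close>

lemma ex_vec_mult_eq_0_except_last:
  fixes M :: "real mat"
  assumes M: "M \<in> carrier_mat r r" and "0 < r"
  obtains x where "x \<in> carrier_vec r" "x \<noteq> 0\<^sub>v r" "\<And>i. i < r - 1 \<Longrightarrow> (M *\<^sub>v x) $ i = 0"
proof -
  \<comment> \<open>\<open>N\<close> is singular because its transpose annihilates the last unit vector.\<close>
  define N where "N = mat r r (\<lambda>(i, j). if i = r - 1 then 0 else M $$ (i, j))"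
  have N: "N \<in> carrier_mat r r" by (simp add: N_def)
  have "N\<^sup>T *\<^sub>v unit_vec r (r - 1) = 0\<^sub>v r"
    using \<open>0 < r\<close> by (intro eq_vecI) (auto simp: N_def)
  moreover have "unit_vec r (r - 1) \<noteq> (0\<^sub>v r :: real vec)"
    using \<open>0 < r\<close> by (intro unit_vec_nonzero) simp
  ultimately have "det N\<^sup>T = 0"
    using det_0_iff_vec_prod_zero [of "N\<^sup>T" r] N unit_vec_carrier
    unfolding transpose_carrier_mat by blast
  then have "det N = 0" using det_transpose [OF N] by simp
  then obtain x where x: "x \<in> carrier_vec r" "x \<noteq> 0\<^sub>v r" "N *\<^sub>v x = 0\<^sub>v r"
    using det_0_iff_vec_prod_zero [OF N] by blast
  have "(M *\<^sub>v x) $ i = 0" if "i < r - 1" for i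
  proof -
    have "row N i = row M i" using that M by (intro eq_vecI) (auto simp: N_def)
    then show ?thesis using arg_cong [OF x(3), of "\<lambda>y. y $ i"] that M N by simp
  qed
  then show ?thesis using that x by blast
qed

section \<open>Partitioned singular value decompositions and their perturbation\<close>

lemma partitioned_svdD:
  assumes svd: "partitioned_svd r A U S V U' S' V'" and A: "A \<in> carrier_mat p q" and r: "r \<le> min p q"
  shows "U \<in> carrier_mat p r" "U' \<in> carrier_mat p (p - r)"
    "V \<in> carrier_mat q r" "V' \<in> carrier_mat q (q - r)"
    "S \<in> carrier_mat r r" "S' \<in> carrier_mat (p - r) (q - r)"
    "U\<^sup>T * U = 1\<^sub>m r" "U'\<^sup>T * U = 0\<^sub>m (p - r) r" "U\<^sup>T * U' = 0\<^sub>m r (p - r)"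
    "U'\<^sup>T * U' = 1\<^sub>m (p - r)" "U * U\<^sup>T + U' * U'\<^sup>T = 1\<^sub>m p"
    "V\<^sup>T * V = 1\<^sub>m r" "V'\<^sup>T * V = 0\<^sub>m (q - r) r" "V\<^sup>T * V' = 0\<^sub>m r (q - r)"
    "V'\<^sup>T * V' = 1\<^sub>m (q - r)" "V * V\<^sup>T + V' * V'\<^sup>T = 1\<^sub>m q"
proof -
  have dim: "dim_row A = p" "dim_col A = q" using A by auto
  note svd' = svd [unfolded partitioned_svd_def dim]
  show U: "U \<in> carrier_mat p r" and U': "U' \<in> carrier_mat p (p - r)"
    and V: "V \<in> carrier_mat q r" and V': "V' \<in> carrier_mat q (q - r)"
    using svd' by blast+
  have "S = mat_diag r (\<lambda>i. singular_value A (i + 1))" using svd' by blast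
  then show "S \<in> carrier_mat r r" by simp
  have "S' = mat (p - r) (q - r) (\<lambda>(i, j). if i = j then singular_value A (r + i + 1) else 0)"
    using svd' by blast
  then show "S' \<in> carrier_mat (p - r) (q - r)" by simp
  have rp: "r \<le> p" and rq: "r \<le> q" using r by auto
  have "orthogonal_matrix p (append_cols U U')" using svd' by blast
  from append_cols_blocks [OF U U' rp this]
  show "U\<^sup>T * U = 1\<^sub>m r" "U'\<^sup>T * U = 0\<^sub>m (p - r) r" "U\<^sup>T * U' = 0\<^sub>m r (p - r)"
    "U'\<^sup>T * U' = 1\<^sub>m (p - r)" "U * U\<^sup>T + U' * U'\<^sup>T = 1\<^sub>m p" by blast+
  have "orthogonal_matrix q (append_cols V V')" using svd' by blast
  from append_cols_blocks [OF V V' rq this]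
  show "V\<^sup>T * V = 1\<^sub>m r" "V'\<^sup>T * V = 0\<^sub>m (q - r) r" "V\<^sup>T * V' = 0\<^sub>m r (q - r)"
    "V'\<^sup>T * V' = 1\<^sub>m (q - r)" "V * V\<^sup>T + V' * V'\<^sup>T = 1\<^sub>m q" by blast+
qed

lemma partitioned_svd_diagonals:
  assumes svd: "partitioned_svd r A U S V U' S' V'" and A: "A \<in> carrier_mat p q"
  shows "S = mat r r (\<lambda>(i, j). if i = j then singular_value A (i + 1) else 0)"
    "S' = mat (p - r) (q - r) (\<lambda>(i, j). if i = j then singular_value A (r + i + 1) else 0)"
proof -
  have "S = mat_diag r (\<lambda>i. singular_value A (i + 1))"
    using svd unfolding partitioned_svd_def by blast
  also have "\<dots> = mat r r (\<lambda>(i, j). if i = j then singular_value A (i + 1) else 0)"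
    unfolding mat_diag_def by (intro cong_mat) auto
  finally show "S = mat r r (\<lambda>(i, j). if i = j then singular_value A (i + 1) else 0)" .
  show "S' = mat (p - r) (q - r) (\<lambda>(i, j). if i = j then singular_value A (r + i + 1) else 0)"
    using svd unfolding partitioned_svd_def carrier_matD [OF A] by blast
qed

lemma partitioned_svd_mult_vec:
  assumes svd: "partitioned_svd r A U S V U' S' V'" and A: "A \<in> carrier_mat p q" and r: "r \<le> min p q"
    and z: "z \<in> carrier_vec q"
  shows "A *\<^sub>v z = U *\<^sub>v (S *\<^sub>v (V\<^sup>T *\<^sub>v z)) + U' *\<^sub>v (S' *\<^sub>v (V'\<^sup>T *\<^sub>v z))"
proof -
  note D = partitioned_svdD [OF svd A r]
  have VT: "V\<^sup>T \<in> carrier_mat r q" "V'\<^sup>T \<in> carrier_mat (q - r) q" using D(3,4) by auto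
  have 1: "U * S \<in> carrier_mat p r" "U' * S' \<in> carrier_mat p (q - r)" using D(1,2,5,6) by auto
  have "A = U * S * V\<^sup>T + U' * S' * V'\<^sup>T" using svd unfolding partitioned_svd_def by blast
  then have "A *\<^sub>v z = (U * S * V\<^sup>T + U' * S' * V'\<^sup>T) *\<^sub>v z" by (rule arg_cong)
  also have "\<dots> = (U * S * V\<^sup>T) *\<^sub>v z + (U' * S' * V'\<^sup>T) *\<^sub>v z"
    by (rule add_mult_distrib_mat_vec [OF mult_carrier_mat [OF 1(1) VT(1)] mult_carrier_mat [OF 1(2) VT(2)] z])
  also have "(U * S * V\<^sup>T) *\<^sub>v z = U *\<^sub>v (S *\<^sub>v (V\<^sup>T *\<^sub>v z))"
    using assoc_mult_mat_vec [OF 1(1) VT(1) z]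
      assoc_mult_mat_vec [OF D(1,5) mult_mat_vec_carrier [OF VT(1) z]] by (rule trans)
  also have "(U' * S' * V'\<^sup>T) *\<^sub>v z = U' *\<^sub>v (S' *\<^sub>v (V'\<^sup>T *\<^sub>v z))"
    using assoc_mult_mat_vec [OF 1(2) VT(2) z]
      assoc_mult_mat_vec [OF D(2,6) mult_mat_vec_carrier [OF VT(2) z]] by (rule trans)
  finally show ?thesis .
qed

lemma transpose_mult_eq_0:
  fixes P Q :: "real mat"
  assumes "P \<in> carrier_mat m k" "Q \<in> carrier_mat m l" "P\<^sup>T * Q = 0\<^sub>m k l" "x \<in> carrier_vec l"
  shows "P\<^sup>T *\<^sub>v (Q *\<^sub>v x) = 0\<^sub>v k"
proof -
  have "P\<^sup>T *\<^sub>v (Q *\<^sub>v x) = (P\<^sup>T * Q) *\<^sub>v x"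
    by (rule assoc_mult_mat_vec [symmetric]) (use assms in \<open>auto simp only: transpose_carrier_mat\<close>)
  also have "\<dots> = 0\<^sub>v k"
    unfolding assms(3) using assms(4) by (intro eq_vecI) auto
  finally show ?thesis .
qed

lemma transpose_mult_eq_id:
  fixes Q :: "real mat"
  assumes "Q \<in> carrier_mat m l" "Q\<^sup>T * Q = 1\<^sub>m l" "x \<in> carrier_vec l"
  shows "Q\<^sup>T *\<^sub>v (Q *\<^sub>v x) = x"
proof -
  have "Q\<^sup>T *\<^sub>v (Q *\<^sub>v x) = (Q\<^sup>T * Q) *\<^sub>v x"
    by (rule assoc_mult_mat_vec [symmetric]) (use assms in \<open>auto simp only: transpose_carrier_mat\<close>)
  then show ?thesis unfolding assms(2) one_mult_mat_vec [OF assms(3)] .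
qed

lemma partitioned_svd_leading:
  assumes svd: "partitioned_svd r A U S V U' S' V'" and A: "A \<in> carrier_mat p q" and r: "r \<le> min p q"
    and y: "y \<in> carrier_vec r"
  shows "A *\<^sub>v (V *\<^sub>v y) = U *\<^sub>v (S *\<^sub>v y)"
proof -
  note D = partitioned_svdD [OF svd A r]
  have "V *\<^sub>v y \<in> carrier_vec q" using D(3) y by simp
  from partitioned_svd_mult_vec [OF svd A r this]
  have "A *\<^sub>v (V *\<^sub>v y) = U *\<^sub>v (S *\<^sub>v y) + U' *\<^sub>v (S' *\<^sub>v 0\<^sub>v (q - r))"
    unfolding transpose_mult_eq_id [OF D(3,12) y] transpose_mult_eq_0 [OF D(4,3,13) y] .
  also have "S' *\<^sub>v 0\<^sub>v (q - r) = 0\<^sub>v (p - r)" using D(6) by (intro eq_vecI) auto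
  also have "U' *\<^sub>v 0\<^sub>v (p - r) = 0\<^sub>v p" using D(2) by (intro eq_vecI) auto
  finally show ?thesis using D(1,5) y by simp
qed

lemma partitioned_svd_leading_lower_bound:
  assumes svd: "partitioned_svd r A U S V U' S' V'" and A: "A \<in> carrier_mat p q" and r: "r \<le> min p q"
    and y: "y \<in> carrier_vec r"
  shows "singular_value A r * l2_norm_vec y \<le> l2_norm_vec (A *\<^sub>v (V *\<^sub>v y))"
proof -
  note D = partitioned_svdD [OF svd A r]
  note S = partitioned_svd_diagonals(1) [OF svd A]
  have "singular_value A r * l2_norm_vec y \<le> l2_norm_vec (S *\<^sub>v y)"
    unfolding S by (rule diag_l2_norm_ge [OF y]) (auto intro: singular_value_antimono singular_value_nonneg)
  also have "\<dots> = l2_norm_vec (A *\<^sub>v (V *\<^sub>v y))"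
    unfolding partitioned_svd_leading [OF svd A r y]
    by (rule isometry_l2_norm [OF D(1,7), symmetric]) (use D(5) y in simp)
  finally show ?thesis .
qed

text \<open>
  The components of \<open>z\<close> along the first \<open>r - 1\<close> right singular vectors vanish, and every
  other right singular vector is stretched by at most the \<open>r\<close>-th singular value.
\<close>

lemma partitioned_svd_trailing_upper_bound:
  assumes svd: "partitioned_svd r A U S V U' S' V'" and A: "A \<in> carrier_mat p q"
    and r: "0 < r" "r \<le> min p q"
    and z: "z \<in> carrier_vec q" and z0: "\<And>i. i < r - 1 \<Longrightarrow> (V\<^sup>T *\<^sub>v z) $ i = 0"
  shows "l2_norm_vec (A *\<^sub>v z) \<le> singular_value A r * l2_norm_vec z"
proof -
  note D = partitioned_svdD [OF svd A r(2)]
  let ?s = "singular_value A r"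
  define a b where "a = V\<^sup>T *\<^sub>v z" and "b = V'\<^sup>T *\<^sub>v z"
  have a: "a \<in> carrier_vec r" and b: "b \<in> carrier_vec (q - r)"
    unfolding a_def b_def using D(3,4) z
    by (auto intro!: mult_mat_vec_carrier simp only: transpose_carrier_mat)
  note S = partitioned_svd_diagonals(1) [OF svd A]
  note S' = partitioned_svd_diagonals(2) [OF svd A]
  have "l2_norm_vec (S *\<^sub>v a) \<le> ?s * l2_norm_vec a"
    unfolding S
  proof (rule diag_l2_norm_le [OF a singular_value_nonneg])
    fix i assume "i < r"
    then consider "i < r - 1" | "i + 1 = r" by linarith
    then show "\<bar>singular_value A (i + 1) * a $ i\<bar> \<le> ?s * \<bar>a $ i\<bar>"
    proof cases
      case 1
      then show ?thesis using z0 by (simp add: a_def)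
    next
      case 2
      then show ?thesis by (simp add: abs_mult singular_value_nonneg)
    qed
  qed
  then have Sa: "(l2_norm_vec (S *\<^sub>v a))\<^sup>2 \<le> (?s * l2_norm_vec a)\<^sup>2" by (rule power_mono) simp
  have "l2_norm_vec (S' *\<^sub>v b) \<le> ?s * l2_norm_vec b"
    unfolding S'
  proof (rule diag_l2_norm_le [OF b singular_value_nonneg])
    fix i
    have "singular_value A (r + i + 1) \<le> ?s" using r(1) by (intro singular_value_antimono) auto
    then show "\<bar>singular_value A (r + i + 1) * b $ i\<bar> \<le> ?s * \<bar>b $ i\<bar>"
      by (simp add: abs_mult singular_value_nonneg mult_right_mono)
  qed
  then have Sb: "(l2_norm_vec (S' *\<^sub>v b))\<^sup>2 \<le> (?s * l2_norm_vec b)\<^sup>2" by (rule power_mono) simp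
  have "(l2_norm_vec (A *\<^sub>v z))\<^sup>2 = (l2_norm_vec (S *\<^sub>v a))\<^sup>2 + (l2_norm_vec (S' *\<^sub>v b))\<^sup>2"
    unfolding partitioned_svd_mult_vec [OF svd A r(2) z] a_def [symmetric] b_def [symmetric]
    by (rule orthogonal_sum_l2_norm [OF D(1,7,2,10,9)]) (use D(5,6) a b in auto)
  also have "\<dots> \<le> ?s\<^sup>2 * ((l2_norm_vec a)\<^sup>2 + (l2_norm_vec b)\<^sup>2)"
    using Sa Sb by (simp add: power_mult_distrib distrib_left)
  also have "\<dots> = (?s * l2_norm_vec z)\<^sup>2"
    unfolding a_def b_def complementary_l2_norm(1) [OF D(3,4,16) z] by (simp add: power_mult_distrib)
  finally show ?thesis
    by (rule power2_le_imp_le) (simp add: singular_value_nonneg)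
qed

text \<open>
  Weyl's inequality at index \<open>r\<close>.  By dimension count, the span of the leading \<open>r\<close> right
  singular vectors of \<open>X\<close> contains some \<open>z \<noteq> 0\<close> orthogonal to the first \<open>r - 1\<close> right
  singular vectors of \<open>X + E\<close>.  On \<open>z\<close> the matrix \<open>X\<close> stretches by at least its
  \<open>r\<close>-th singular value and \<open>X + E\<close> by at most its own.
\<close>

lemma singular_value_perturbation:
  assumes X: "X \<in> carrier_mat p q" and E: "E \<in> carrier_mat p q" and r: "0 < r" "r \<le> min p q"
    and svd: "partitioned_svd r X U S V U' S' V'"
    and svd_hat: "partitioned_svd r (X + E) Uh Sh Vh Uh' Sh' Vh'"
  shows "singular_value X r \<le> singular_value (X + E) r + spectral_norm E"
proof -
  note D = partitioned_svdD [OF svd X r(2)]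
  have XE: "X + E \<in> carrier_mat p q" using X E by simp
  note Dh = partitioned_svdD [OF svd_hat XE r(2)]
  have VhT: "Vh\<^sup>T \<in> carrier_mat r q" using Dh(3) by simp
  obtain x where x: "x \<in> carrier_vec r" "x \<noteq> 0\<^sub>v r"
    and x0: "\<And>i. i < r - 1 \<Longrightarrow> ((Vh\<^sup>T * V) *\<^sub>v x) $ i = 0"
    using ex_vec_mult_eq_0_except_last [OF mult_carrier_mat [OF VhT D(3)] r(1)] by blast
  define z where "z = V *\<^sub>v x"
  have z: "z \<in> carrier_vec q" using D(3) x by (simp add: z_def)
  have nz: "l2_norm_vec z = l2_norm_vec x"
    unfolding z_def by (rule isometry_l2_norm [OF D(3,12) x(1)])
  have "singular_value X r * l2_norm_vec x \<le> l2_norm_vec (X *\<^sub>v z)"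
    unfolding z_def by (rule partitioned_svd_leading_lower_bound [OF svd X r(2) x(1)])
  also have "X *\<^sub>v z = (X + E) *\<^sub>v z + - 1 \<cdot>\<^sub>v (E *\<^sub>v z)"
    unfolding add_mult_distrib_mat_vec [OF X E z] using X E z by (intro eq_vecI) auto
  also have "l2_norm_vec \<dots> \<le> l2_norm_vec ((X + E) *\<^sub>v z) + l2_norm_vec (- 1 \<cdot>\<^sub>v (E *\<^sub>v z))"
    by (intro l2_norm_vec_triangle [where n = p] smult_carrier_vec [THEN iffD2]
        mult_mat_vec_carrier [OF XE z] mult_mat_vec_carrier [OF E z])
  also have "\<dots> = l2_norm_vec ((X + E) *\<^sub>v z) + l2_norm_vec (E *\<^sub>v z)"
    by (simp add: l2_norm_vec_smult)
  also have "\<dots> \<le> singular_value (X + E) r * l2_norm_vec z + spectral_norm E * l2_norm_vec z"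
  proof (rule add_mono)
    have "(Vh\<^sup>T *\<^sub>v z) $ i = 0" if "i < r - 1" for i
      using x0 [OF that] unfolding assoc_mult_mat_vec [OF VhT D(3) x(1)] z_def .
    then show "l2_norm_vec ((X + E) *\<^sub>v z) \<le> singular_value (X + E) r * l2_norm_vec z"
      by (rule partitioned_svd_trailing_upper_bound [OF svd_hat XE r z])
    show "l2_norm_vec (E *\<^sub>v z) \<le> spectral_norm E * l2_norm_vec z"
      by (rule l2_norm_mult_mat_vec_le_spectral_norm [OF E z])
  qed
  finally have "singular_value X r * l2_norm_vec x
      \<le> (singular_value (X + E) r + spectral_norm E) * l2_norm_vec x"
    unfolding nz by (simp add: distrib_right)
  moreover have "0 < l2_norm_vec x"
    using l2_norm_vec_eq_0_iff [OF x(1)] x(2) l2_norm_vec_nonneg [of x] by linarith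
  ultimately show ?thesis by simp
qed

section \<open>Canonical angles and the Procrustes residual\<close>

lemma sin_Theta_eq_mat_diag:
  "sin_Theta Uh U = mat_diag (dim_col U) (\<lambda>i. sin (arccos (singular_value (U\<^sup>T * Uh) (i + 1))))"
  unfolding sin_Theta_def canonical_angles_def mat_diag_def by (intro cong_mat) auto

text \<open>
  Pythagoras for the parts of \<open>Vh x\<close>, a vector as long as \<open>x\<close>, in the spans of \<open>V\<close>
  and \<open>V'\<close>; this is the identity behind the cosines and sines of the canonical angles.
\<close>

lemma overlap_contraction:
  assumes V: "V \<in> carrier_mat q r" and V': "V' \<in> carrier_mat q k"
    and sum: "V * V\<^sup>T + V' * V'\<^sup>T = 1\<^sub>m q"
    and Vh: "Vh \<in> carrier_mat q r" "Vh\<^sup>T * Vh = 1\<^sub>m r" and x: "x \<in> carrier_vec r"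
  shows "(l2_norm_vec ((V\<^sup>T * Vh) *\<^sub>v x))\<^sup>2 + (l2_norm_vec (V'\<^sup>T *\<^sub>v (Vh *\<^sub>v x)))\<^sup>2 = (l2_norm_vec x)\<^sup>2"
proof -
  have VT: "V\<^sup>T \<in> carrier_mat r q" using V by simp
  have "Vh *\<^sub>v x \<in> carrier_vec q" using Vh(1) x by simp
  from complementary_l2_norm(1) [OF V V' sum this] show ?thesis
    unfolding assoc_mult_mat_vec [OF VT Vh(1) x] isometry_l2_norm [OF Vh x] .
qed

lemma overlap_singular_value_le_1:
  assumes V: "V \<in> carrier_mat q r" and V': "V' \<in> carrier_mat q k"
    and sum: "V * V\<^sup>T + V' * V'\<^sup>T = 1\<^sub>m q"
    and Vh: "Vh \<in> carrier_mat q r" "Vh\<^sup>T * Vh = 1\<^sub>m r"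
  shows "singular_value (V\<^sup>T * Vh) j \<le> 1"
proof (cases "1 \<le> j \<and> j \<le> min (dim_row (V\<^sup>T * Vh)) (dim_col (V\<^sup>T * Vh))")
  case True
  then obtain v where v: "v \<in> carrier_vec (dim_col (V\<^sup>T * Vh))" "l2_norm_vec v = 1"
    "singular_value (V\<^sup>T * Vh) j = l2_norm_vec ((V\<^sup>T * Vh) *\<^sub>v v)"
    using singular_value_attained [of j "V\<^sup>T * Vh"] by blast
  have "v \<in> carrier_vec r" using v(1) Vh(1) by simp
  from overlap_contraction [OF V V' sum Vh this]
  have "(singular_value (V\<^sup>T * Vh) j)\<^sup>2 \<le> 1"
    unfolding v(2,3) one_power2 using zero_le_power2 [of "l2_norm_vec (V'\<^sup>T *\<^sub>v (Vh *\<^sub>v v))"] by linarith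
  then show ?thesis using power2_le_imp_le [of _ 1] by simp
next
  case False
  then have "singular_value (V\<^sup>T * Vh) j = 0" unfolding singular_value_def by (rule if_not_P)
  then show ?thesis by simp
qed

text \<open>
  Read as \<open>1 - cos\<^sup>2 \<theta> \<le> \<parallel>sin \<Theta>\<parallel>\<^sub>2\<^sup>2\<close> for the largest canonical angle, whose cosine is
  the smallest singular value.  Cosines in \<open>[0, 1]\<close> are what makes \<open>arccos\<close> meaningful here.
\<close>

lemma cos_sin_Theta_bound:
  assumes V: "V \<in> carrier_mat q r" and V': "V' \<in> carrier_mat q k"
    and sum: "V * V\<^sup>T + V' * V'\<^sup>T = 1\<^sub>m q"
    and Vh: "Vh \<in> carrier_mat q r" "Vh\<^sup>T * Vh = 1\<^sub>m r" and "0 < r"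
  shows "1 - (singular_value (V\<^sup>T * Vh) r)\<^sup>2 \<le> (spectral_norm (sin_Theta Vh V))\<^sup>2"
    "0 \<le> spectral_norm (sin_Theta Vh V)"
proof -
  let ?s = "singular_value (V\<^sup>T * Vh) r"
  have s1: "?s \<le> 1" using overlap_singular_value_le_1 [OF V V' sum Vh] .
  have s0: "0 \<le> ?s" by (rule singular_value_nonneg)
  have "\<bar>sin (arccos (singular_value (V\<^sup>T * Vh) (r - 1 + 1)))\<bar> \<le> spectral_norm (sin_Theta Vh V)"
    unfolding sin_Theta_eq_mat_diag carrier_matD(2) [OF V]
    by (rule abs_diag_le_spectral_norm) (use \<open>0 < r\<close> in simp)
  then have le: "\<bar>sin (arccos ?s)\<bar> \<le> spectral_norm (sin_Theta Vh V)" using \<open>0 < r\<close> by simp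
  then show "0 \<le> spectral_norm (sin_Theta Vh V)" by (rule order_trans [rotated]) simp
  have "1 - ?s\<^sup>2 = (sin (arccos ?s))\<^sup>2"
    using s0 s1 by (simp add: sin_squared_eq)
  also have "\<dots> \<le> (spectral_norm (sin_Theta Vh V))\<^sup>2"
    using power_mono [OF le, of 2] by simp
  finally show "1 - ?s\<^sup>2 \<le> (spectral_norm (sin_Theta Vh V))\<^sup>2" .
qed

text \<open>
  For the largest canonical angle \<open>\<theta>\<close>, the part of \<open>Vh x\<close> inside the span of \<open>V\<close> has
  norm at least \<open>cos \<theta> \<bar>x\<bar>\<close>; Pythagoras leaves at most \<open>sin \<theta> \<bar>x\<bar>\<close> outside.
\<close>

lemma complement_overlap_le_sin_Theta:
  assumes V: "V \<in> carrier_mat q r" and V': "V' \<in> carrier_mat q k"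
    and sum: "V * V\<^sup>T + V' * V'\<^sup>T = 1\<^sub>m q"
    and Vh: "Vh \<in> carrier_mat q r" "Vh\<^sup>T * Vh = 1\<^sub>m r" and "0 < r" and x: "x \<in> carrier_vec r"
  shows "l2_norm_vec (V'\<^sup>T *\<^sub>v (Vh *\<^sub>v x)) \<le> spectral_norm (sin_Theta Vh V) * l2_norm_vec x"
proof -
  let ?s = "singular_value (V\<^sup>T * Vh) r"
  note sin = cos_sin_Theta_bound [OF V V' sum Vh \<open>0 < r\<close>]
  have M: "V\<^sup>T * Vh \<in> carrier_mat r r" using V Vh(1) by simp
  have "(?s * l2_norm_vec x)\<^sup>2 \<le> (l2_norm_vec ((V\<^sup>T * Vh) *\<^sub>v x))\<^sup>2"
    using last_singular_value_le [OF M \<open>0 < r\<close> x]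
    by (rule power_mono) (simp add: singular_value_nonneg)
  then have "(l2_norm_vec (V'\<^sup>T *\<^sub>v (Vh *\<^sub>v x)))\<^sup>2 \<le> (1 - ?s\<^sup>2) * (l2_norm_vec x)\<^sup>2"
    using overlap_contraction [OF V V' sum Vh x] by (simp add: power_mult_distrib left_diff_distrib)
  also have "\<dots> \<le> (spectral_norm (sin_Theta Vh V) * l2_norm_vec x)\<^sup>2"
    using sin(1) by (simp add: power_mult_distrib mult_right_mono)
  finally show ?thesis by (rule power2_le_imp_le) (use sin(2) in simp)
qed

lemma is_procrustes_carrier:
  assumes U: "U \<in> carrier_mat p r" and Uh: "Uh \<in> carrier_mat p r" and "is_procrustes U Uh W"
  shows "W \<in> carrier_mat r r"
proof -
  have M: "U\<^sup>T * Uh \<in> carrier_mat r r" using U Uh by simp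
  obtain W1 S W2 where "is_svd (U\<^sup>T * Uh) W1 S W2" and W: "W = W1 * W2\<^sup>T"
    using assms(3) unfolding is_procrustes_def by blast
  then have "W1 \<in> carrier_mat r r" "W2\<^sup>T \<in> carrier_mat r r"
    unfolding is_svd_def orthogonal_matrix_def carrier_matD [OF M] transpose_carrier_mat by blast+
  then show ?thesis unfolding W by (rule mult_carrier_mat)
qed

text \<open>
  From \<open>U\<^sup>T Uh = W\<^sub>1 S W\<^sub>2\<^sup>T\<close> and \<open>W = W\<^sub>1 W\<^sub>2\<^sup>T\<close> the residual is
  \<open>W\<^sub>1 (S - 1) W\<^sub>2\<^sup>T\<close>, of norm \<open>1 - cos \<theta>\<close> for the largest canonical angle.  As the cosine
  lies in \<open>[0, 1]\<close>, this is at most \<open>1 - cos\<^sup>2 \<theta>\<close>.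
\<close>

lemma procrustes_residual_le:
  assumes U: "U \<in> carrier_mat p r" and U': "U' \<in> carrier_mat p k"
    and sum: "U * U\<^sup>T + U' * U'\<^sup>T = 1\<^sub>m p"
    and Uh: "Uh \<in> carrier_mat p r" "Uh\<^sup>T * Uh = 1\<^sub>m r" and "0 < r"
    and W: "is_procrustes U Uh W" and x: "x \<in> carrier_vec r"
  shows "l2_norm_vec ((U\<^sup>T * Uh) *\<^sub>v x - W *\<^sub>v x) \<le> (spectral_norm (sin_Theta Uh U))\<^sup>2 * l2_norm_vec x"
proof -
  define M where "M = U\<^sup>T * Uh"
  have M: "M \<in> carrier_mat r r" unfolding M_def using U Uh(1) by simp
  let ?\<sigma> = "singular_value M"
  obtain W1 S W2 where svd: "is_svd M W1 S W2" and W_eq: "W = W1 * W2\<^sup>T"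
    using W unfolding is_procrustes_def M_def by blast
  note svd' = svd [unfolded is_svd_def orthogonal_matrix_def carrier_matD [OF M]]
  have W1: "W1 \<in> carrier_mat r r" "W1\<^sup>T * W1 = 1\<^sub>m r"
    and W2: "W2 \<in> carrier_mat r r" "W2 * W2\<^sup>T = 1\<^sub>m r"
    and S_eq: "S = mat r r (\<lambda>(i, j). if i = j then ?\<sigma> (i + 1) else 0)"
    and M_eq: "M = W1 * S * W2\<^sup>T"
    using svd' by blast+
  have S: "S \<in> carrier_mat r r" unfolding S_eq by simp
  have W2T: "W2\<^sup>T \<in> carrier_mat r r" using W2(1) by simp
  define u where "u = W2\<^sup>T *\<^sub>v x"
  have u: "u \<in> carrier_vec r" unfolding u_def by (rule mult_mat_vec_carrier [OF W2T x])
  have nu: "l2_norm_vec u = l2_norm_vec x"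
    unfolding u_def by (rule isometry_l2_norm [OF W2T _ x]) (simp only: transpose_transpose W2(2))
  have Su: "S *\<^sub>v u \<in> carrier_vec r" by (rule mult_mat_vec_carrier [OF S u])
  let ?D = "mat r r (\<lambda>(i, j). if i = j then ?\<sigma> (i + 1) - 1 else 0)"
  have "M *\<^sub>v x = W1 *\<^sub>v (S *\<^sub>v u)"
    unfolding M_eq assoc_mult_mat_vec [OF mult_carrier_mat [OF W1(1) S] W2T x] u_def [symmetric]
    by (rule assoc_mult_mat_vec [OF W1(1) S u])
  moreover have "W *\<^sub>v x = W1 *\<^sub>v u"
    unfolding W_eq u_def by (rule assoc_mult_mat_vec [OF W1(1) W2T x])
  ultimately have "M *\<^sub>v x - W *\<^sub>v x = W1 *\<^sub>v (S *\<^sub>v u - u)"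
    unfolding mult_minus_distrib_mat_vec [OF W1(1) Su u] by simp
  also have "S *\<^sub>v u - u = ?D *\<^sub>v u"
    unfolding S_eq diag_mult_vec [OF u] using u by (intro eq_vecI) (auto simp: left_diff_distrib)
  finally have "l2_norm_vec (M *\<^sub>v x - W *\<^sub>v x) = l2_norm_vec (?D *\<^sub>v u)"
    using isometry_l2_norm [OF W1 mult_mat_vec_carrier [OF mat_carrier u]] by simp
  also have "\<dots> \<le> (1 - ?\<sigma> r) * l2_norm_vec u"
  proof (rule diag_l2_norm_le [OF u])
    show "0 \<le> 1 - ?\<sigma> r"
      using overlap_singular_value_le_1 [OF U U' sum Uh] unfolding M_def by simp
    fix i assume "i < r"
    then have "?\<sigma> r \<le> ?\<sigma> (i + 1)" by (intro singular_value_antimono) auto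
    moreover have "?\<sigma> (i + 1) \<le> 1"
      unfolding M_def by (rule overlap_singular_value_le_1 [OF U U' sum Uh])
    ultimately show "\<bar>(?\<sigma> (i + 1) - 1) * u $ i\<bar> \<le> (1 - ?\<sigma> r) * \<bar>u $ i\<bar>"
      unfolding abs_mult by (intro mult_right_mono) auto
  qed
  also have "\<dots> \<le> (spectral_norm (sin_Theta Uh U))\<^sup>2 * l2_norm_vec u"
  proof (rule mult_right_mono)
    have "?\<sigma> r * ?\<sigma> r \<le> 1 * ?\<sigma> r"
      unfolding M_def
      by (rule mult_right_mono [OF overlap_singular_value_le_1 [OF U U' sum Uh] singular_value_nonneg])
    then show "1 - ?\<sigma> r \<le> (spectral_norm (sin_Theta Uh U))\<^sup>2"
      using cos_sin_Theta_bound(1) [OF U U' sum Uh \<open>0 < r\<close>, folded M_def]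
      by (simp add: power2_eq_square)
  qed simp
  finally show "l2_norm_vec ((U\<^sup>T * Uh) *\<^sub>v x - W *\<^sub>v x)
      \<le> (spectral_norm (sin_Theta Uh U))\<^sup>2 * l2_norm_vec x"
    unfolding nu M_def .
qed

section \<open>The two-to-infinity bound\<close>

text \<open>
  The vector \<open>w\<close> is the projection of \<open>z\<close> on the span of \<open>V'\<close>.  That the projection fixes
  \<open>w\<close> lets a factor \<open>V' V'\<^sup>T\<close> be kept inside a matrix norm while the small norm of \<open>w\<close> is
  used outside it.
\<close>

lemma complementary_projection:
  fixes V V' :: "real mat"
  assumes V: "V \<in> carrier_mat q r" and V': "V' \<in> carrier_mat q k" "V'\<^sup>T * V' = 1\<^sub>m k"
    and sum: "V * V\<^sup>T + V' * V'\<^sup>T = 1\<^sub>m q" and z: "z \<in> carrier_vec q"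
  obtains w where "w \<in> carrier_vec q" "z = (V * V\<^sup>T) *\<^sub>v z + w" "(V' * V'\<^sup>T) *\<^sub>v w = w"
    "l2_norm_vec w = l2_norm_vec (V'\<^sup>T *\<^sub>v z)"
proof
  have T: "V'\<^sup>T \<in> carrier_mat k q" using V'(1) by simp
  have a: "V'\<^sup>T *\<^sub>v z \<in> carrier_vec k" by (rule mult_mat_vec_carrier [OF T z])
  let ?w = "V' *\<^sub>v (V'\<^sup>T *\<^sub>v z)"
  show w: "?w \<in> carrier_vec q" by (rule mult_mat_vec_carrier [OF V'(1) a])
  show "z = (V * V\<^sup>T) *\<^sub>v z + ?w"
    using complementary_l2_norm(2) [OF V V'(1) sum z]
    unfolding assoc_mult_mat_vec [OF V'(1) T z] .
  show "(V' * V'\<^sup>T) *\<^sub>v ?w = ?w"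
    unfolding assoc_mult_mat_vec [OF V'(1) T w] transpose_mult_eq_id [OF V' a] ..
  show "l2_norm_vec ?w = l2_norm_vec (V'\<^sup>T *\<^sub>v z)"
    by (rule isometry_l2_norm [OF V' a])
qed

lemma sandwiched_mult_vec:
  fixes P A Q :: "real mat"
  assumes "P \<in> carrier_mat m p" "A \<in> carrier_mat p q" "Q \<in> carrier_mat q q" "z \<in> carrier_vec q"
  shows "(P * A * Q) *\<^sub>v z = P *\<^sub>v (A *\<^sub>v (Q *\<^sub>v z))"
  unfolding assoc_mult_mat_vec [OF mult_carrier_mat [OF assms(1,2)] assms(3,4)]
  by (rule assoc_mult_mat_vec [OF assms(1,2) mult_mat_vec_carrier [OF assms(3,4)]])

theorem theorem3p7:
  fixes p\<^sub>1 p\<^sub>2 r :: nat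
    and X E X_hat :: "real mat"
    and U \<Sigma> V U\<^sub>p \<Sigma>\<^sub>p V\<^sub>p :: "real mat"
    and U_hat \<Sigma>_hat V_hat U\<^sub>p_hat \<Sigma>\<^sub>p_hat V\<^sub>p_hat :: "real mat"
    and W\<^sub>U :: "real mat"
  assumes "0 < p\<^sub>1" and "0 < p\<^sub>2" and "0 < r" and "r \<le> min p\<^sub>1 p\<^sub>2"
    and "X \<in> carrier_mat p\<^sub>1 p\<^sub>2" and "E \<in> carrier_mat p\<^sub>1 p\<^sub>2" and "X_hat = X + E"
    and "partitioned_svd r X U \<Sigma> V U\<^sub>p \<Sigma>\<^sub>p V\<^sub>p"
    and "partitioned_svd r X_hat U_hat \<Sigma>_hat V_hat U\<^sub>p_hat \<Sigma>\<^sub>p_hat V\<^sub>p_hat"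
    and "is_procrustes U U_hat W\<^sub>U"
    and "singular_value X r > singular_value X (r + 1)" and "singular_value X (r + 1) \<ge> 0"
    and "singular_value X r \<ge> 2 * spectral_norm E"
  shows "two_inf_norm (U_hat - U * W\<^sub>U)
    \<le> 2 * (two_inf_norm ((U\<^sub>p * U\<^sub>p\<^sup>T) * E * (V * V\<^sup>T)) / singular_value X r)
      + 2 * (two_inf_norm ((U\<^sub>p * U\<^sub>p\<^sup>T) * E * (V\<^sub>p * V\<^sub>p\<^sup>T)) / singular_value X r)
          * spectral_norm (sin_Theta V_hat V)
      + 2 * (two_inf_norm ((U\<^sub>p * U\<^sub>p\<^sup>T) * X * (V\<^sub>p * V\<^sub>p\<^sup>T)) / singular_value X r)
          * spectral_norm (sin_Theta V_hat V)
      + (spectral_norm (sin_Theta U_hat U))\<^sup>2 * two_inf_norm U"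
    (is "_ \<le> 2 * (?nEV / ?\<sigma>) + 2 * (?nE / ?\<sigma>) * ?sV + 2 * (?nX / ?\<sigma>) * ?sV + ?sU\<^sup>2 * ?nU")
proof -
  note r = \<open>r \<le> min p\<^sub>1 p\<^sub>2\<close> and X = \<open>X \<in> carrier_mat p\<^sub>1 p\<^sub>2\<close> and E = \<open>E \<in> carrier_mat p\<^sub>1 p\<^sub>2\<close>
  note svd = \<open>partitioned_svd r X U \<Sigma> V U\<^sub>p \<Sigma>\<^sub>p V\<^sub>p\<close>
  note svd_hat = \<open>partitioned_svd r X_hat U_hat \<Sigma>_hat V_hat U\<^sub>p_hat \<Sigma>\<^sub>p_hat V\<^sub>p_hat\<close>
  have X_hat: "X_hat \<in> carrier_mat p\<^sub>1 p\<^sub>2" using X E \<open>X_hat = X + E\<close> by simp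
  note D = partitioned_svdD [OF svd X r]
  note Dh = partitioned_svdD [OF svd_hat X_hat r]
  let ?\<sigma>h = "singular_value X_hat"
  let ?P = "U\<^sub>p * U\<^sub>p\<^sup>T" and ?Q = "V * V\<^sup>T" and ?Q' = "V\<^sub>p * V\<^sub>p\<^sup>T"
  have T: "U\<^sup>T \<in> carrier_mat r p\<^sub>1" "U\<^sub>p\<^sup>T \<in> carrier_mat (p\<^sub>1 - r) p\<^sub>1"
    "V\<^sup>T \<in> carrier_mat r p\<^sub>2" "V\<^sub>p\<^sup>T \<in> carrier_mat (p\<^sub>2 - r) p\<^sub>2"
    using D(1-4) by simp_all
  have P: "?P \<in> carrier_mat p\<^sub>1 p\<^sub>1" and Q: "?Q \<in> carrier_mat p\<^sub>2 p\<^sub>2" and Q': "?Q' \<in> carrier_mat p\<^sub>2 p\<^sub>2"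
    using mult_carrier_mat [OF D(2) T(2)] mult_carrier_mat [OF D(3) T(3)] mult_carrier_mat [OF D(4) T(4)] .
  note PEQ = mult_carrier_mat [OF mult_carrier_mat [OF P E] Q]
    and PEQ' = mult_carrier_mat [OF mult_carrier_mat [OF P E] Q']
    and PXQ' = mult_carrier_mat [OF mult_carrier_mat [OF P X] Q']
  have \<sigma>: "0 < ?\<sigma>" using assms(11,12) by linarith
  have "?\<sigma> \<le> ?\<sigma>h r + spectral_norm E"
    using singular_value_perturbation [OF X E \<open>0 < r\<close> r svd] svd_hat unfolding \<open>X_hat = X + E\<close> by blast
  then have \<sigma>h: "?\<sigma> / 2 \<le> ?\<sigma>h r" using assms(13) by linarith
  then have \<sigma>h_pos: "0 < ?\<sigma>h r" using \<sigma> by linarith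
  note W = procrustes_residual_le [OF D(1,2,11) Dh(1,7) \<open>0 < r\<close> \<open>is_procrustes U U_hat W\<^sub>U\<close>]
  have W_carrier: "W\<^sub>U \<in> carrier_mat r r"
    by (rule is_procrustes_carrier [OF D(1) Dh(1) \<open>is_procrustes U U_hat W\<^sub>U\<close>])
  have sV: "0 \<le> ?sV" by (rule cos_sin_Theta_bound(2) [OF D(3,4,16) Dh(3,12) \<open>0 < r\<close>])
  show ?thesis
  proof (rule two_inf_norm_le [OF minus_carrier_mat [OF mult_carrier_mat [OF D(1) W_carrier]]
        \<open>0 < p\<^sub>1\<close> \<open>0 < r\<close>])
    fix x i assume x: "x \<in> carrier_vec r" and x1: "l2_norm_vec x = 1" and i: "i < p\<^sub>1"
    \<comment> \<open>\<open>y = \<Sigma>_hat\<^sup>-\<^sup>1 x\<close>, so that \<open>U_hat x = X_hat z\<close> for \<open>z = V_hat y\<close>.\<close>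
    define y where "y = mat r r (\<lambda>(i, j). if i = j then 1 / ?\<sigma>h (i + 1) else 0) *\<^sub>v x"
    have y: "y \<in> carrier_vec r" unfolding y_def by (rule mult_mat_vec_carrier [OF mat_carrier x])
    have \<sigma>h_ge: "?\<sigma>h r \<le> ?\<sigma>h (j + 1)" if "j < r" for j
      using that by (intro singular_value_antimono) auto
    have Sy: "\<Sigma>_hat *\<^sub>v y = x"
      unfolding partitioned_svd_diagonals(1) [OF svd_hat X_hat] diag_mult_vec [OF y]
    proof (rule eq_vecI)
      fix j assume "j < dim_vec x"
      then have j: "j < r" using x by simp
      then have "?\<sigma>h (j + 1) \<noteq> 0" using \<sigma>h_ge [OF j] \<sigma>h_pos by linarith
      then show "vec r (\<lambda>i. if i < r then ?\<sigma>h (i + 1) * y $ i else 0) $ j = x $ j"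
        using j unfolding y_def diag_mult_vec [OF x] by simp
    qed (use x in simp)
    have "l2_norm_vec y \<le> 2 / ?\<sigma> * l2_norm_vec x"
      unfolding y_def
    proof (rule diag_l2_norm_le [OF x])
      fix j assume "j < r"
      then have "?\<sigma> / 2 \<le> ?\<sigma>h (j + 1)" using \<sigma>h_ge [of j] \<sigma>h by linarith
      then have "1 / ?\<sigma>h (j + 1) \<le> 1 / (?\<sigma> / 2)" using \<sigma> by (intro frac_le) auto
      moreover have "0 \<le> 1 / ?\<sigma>h (j + 1)" by (simp add: singular_value_nonneg)
      ultimately have "\<bar>1 / ?\<sigma>h (j + 1)\<bar> \<le> 2 / ?\<sigma>" by simp
      then show "\<bar>1 / ?\<sigma>h (j + 1) * x $ j\<bar> \<le> 2 / ?\<sigma> * \<bar>x $ j\<bar>"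
        unfolding abs_mult by (rule mult_right_mono) simp
    qed (use \<sigma> in simp)
    then have ny: "l2_norm_vec y \<le> 2 / ?\<sigma>" unfolding x1 by simp
    define z where "z = V_hat *\<^sub>v y"
    have z: "z \<in> carrier_vec p\<^sub>2" unfolding z_def by (rule mult_mat_vec_carrier [OF Dh(3) y])
    have nz: "l2_norm_vec z \<le> 2 / ?\<sigma>" unfolding z_def isometry_l2_norm [OF Dh(3,12) y] by (rule ny)
    obtain w where w: "w \<in> carrier_vec p\<^sub>2" and zw: "z = ?Q *\<^sub>v z + w" and Qw: "?Q' *\<^sub>v w = w"
      and nw: "l2_norm_vec w = l2_norm_vec (V\<^sub>p\<^sup>T *\<^sub>v z)"
      using complementary_projection [OF D(3,4,15,16) z] .
    have "l2_norm_vec w \<le> ?sV * l2_norm_vec y"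
      unfolding nw z_def by (rule complement_overlap_le_sin_Theta [OF D(3,4,16) Dh(3,12) \<open>0 < r\<close> y])
    also have "\<dots> \<le> ?sV * (2 / ?\<sigma>)" by (rule mult_left_mono [OF ny sV])
    finally have nw: "l2_norm_vec w \<le> ?sV * (2 / ?\<sigma>)" .
    have Qz: "?Q *\<^sub>v z \<in> carrier_vec p\<^sub>2" by (rule mult_mat_vec_carrier [OF Q z])
    \<comment> \<open>The part of \<open>z\<close> along \<open>V\<close> is merely as short as \<open>z\<close>; the other part, \<open>w\<close>, gains
        the factor \<open>sin \<Theta>\<close>.\<close>
    have split: "?P *\<^sub>v (A *\<^sub>v z) = (?P * A * ?Q) *\<^sub>v z + (?P * A * ?Q') *\<^sub>v w"
      if A: "A \<in> carrier_mat p\<^sub>1 p\<^sub>2" for A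
    proof -
      have "A *\<^sub>v z = A *\<^sub>v (?Q *\<^sub>v z) + A *\<^sub>v w"
        by (subst zw) (rule mult_add_distrib_mat_vec [OF A Qz w])
      then have "?P *\<^sub>v (A *\<^sub>v z) = ?P *\<^sub>v (A *\<^sub>v (?Q *\<^sub>v z)) + ?P *\<^sub>v (A *\<^sub>v w)"
        using mult_add_distrib_mat_vec [OF P mult_mat_vec_carrier [OF A Qz] mult_mat_vec_carrier [OF A w]]
        by (simp only:)
      then show ?thesis
        unfolding sandwiched_mult_vec [OF P A Q z] sandwiched_mult_vec [OF P A Q' w] Qw .
    qed
    \<comment> \<open>\<open>X\<close> maps the span of \<open>V\<close> into that of \<open>U\<close>, which \<open>P\<close> annihilates.\<close>
    have PXQ: "(?P * X * ?Q) *\<^sub>v z = 0\<^sub>v p\<^sub>1"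
    proof -
      have c: "V\<^sup>T *\<^sub>v z \<in> carrier_vec r" by (rule mult_mat_vec_carrier [OF T(3) z])
      have Sc: "\<Sigma> *\<^sub>v (V\<^sup>T *\<^sub>v z) \<in> carrier_vec r" by (rule mult_mat_vec_carrier [OF D(5) c])
      have "(?P * X * ?Q) *\<^sub>v z = ?P *\<^sub>v (U *\<^sub>v (\<Sigma> *\<^sub>v (V\<^sup>T *\<^sub>v z)))"
        unfolding sandwiched_mult_vec [OF P X Q z] assoc_mult_mat_vec [OF D(3) T(3) z]
          partitioned_svd_leading [OF svd X r c] ..
      also have "\<dots> = U\<^sub>p *\<^sub>v 0\<^sub>v (p\<^sub>1 - r)"
        unfolding assoc_mult_mat_vec [OF D(2) T(2) mult_mat_vec_carrier [OF D(1) Sc]]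
          transpose_mult_eq_0 [OF D(2,1,8) Sc] ..
      also have "\<dots> = 0\<^sub>v p\<^sub>1" using D(2) by (intro eq_vecI) auto
      finally show ?thesis .
    qed
    define e where "e = (U\<^sup>T * U_hat) *\<^sub>v x - W\<^sub>U *\<^sub>v x"
    have Ux: "U_hat *\<^sub>v x \<in> carrier_vec p\<^sub>1" by (rule mult_mat_vec_carrier [OF Dh(1) x])
    have UUx: "(U\<^sup>T * U_hat) *\<^sub>v x \<in> carrier_vec r" and Wx: "W\<^sub>U *\<^sub>v x \<in> carrier_vec r"
      using mult_mat_vec_carrier [OF mult_carrier_mat [OF T(1) Dh(1)] x] mult_mat_vec_carrier [OF W_carrier x] .
    have e: "e \<in> carrier_vec r" unfolding e_def using UUx Wx by (rule minus_carrier_vec)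
    have ne: "l2_norm_vec e \<le> ?sU\<^sup>2" using W [OF x] unfolding e_def x1 by simp
    have "X_hat *\<^sub>v z = U_hat *\<^sub>v x"
      unfolding z_def partitioned_svd_leading [OF svd_hat X_hat r y] Sy ..
    then have Uxz: "U_hat *\<^sub>v x = X *\<^sub>v z + E *\<^sub>v z"
      unfolding \<open>X_hat = X + E\<close> add_mult_distrib_mat_vec [OF X E z] by (rule sym)
    have PUx: "?P *\<^sub>v (U_hat *\<^sub>v x) = ((?P * X * ?Q) *\<^sub>v z + (?P * X * ?Q') *\<^sub>v w)
        + ((?P * E * ?Q) *\<^sub>v z + (?P * E * ?Q') *\<^sub>v w)"
      unfolding Uxz split [OF X, symmetric] split [OF E, symmetric]
      by (rule mult_add_distrib_mat_vec [OF P mult_mat_vec_carrier [OF X z] mult_mat_vec_carrier [OF E z]])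
    have dim: "i < dim_vec (A *\<^sub>v v)" if "A \<in> carrier_mat p\<^sub>1 n" for A :: "real mat" and v n
      using that i by simp
    have "(U_hat - U * W\<^sub>U) *\<^sub>v x = U_hat *\<^sub>v x - U *\<^sub>v (W\<^sub>U *\<^sub>v x)"
      unfolding minus_mult_distrib_mat_vec [OF Dh(1) mult_carrier_mat [OF D(1) W_carrier] x]
        assoc_mult_mat_vec [OF D(1) W_carrier x] ..
    then have "((U_hat - U * W\<^sub>U) *\<^sub>v x) $ i = (U_hat *\<^sub>v x) $ i - (U *\<^sub>v (W\<^sub>U *\<^sub>v x)) $ i"
      using index_minus_vec(1) [OF dim [OF D(1)]] by (rule arg_cong [THEN trans])
    moreover have "U_hat *\<^sub>v x = U *\<^sub>v ((U\<^sup>T * U_hat) *\<^sub>v x) + ?P *\<^sub>v (U_hat *\<^sub>v x)"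
      using complementary_l2_norm(2) [OF D(1,2,11) Ux]
      unfolding assoc_mult_mat_vec [OF D(1) T(1) Ux] assoc_mult_mat_vec [OF T(1) Dh(1) x] .
    then have "(U_hat *\<^sub>v x) $ i = (U *\<^sub>v ((U\<^sup>T * U_hat) *\<^sub>v x)) $ i + (?P *\<^sub>v (U_hat *\<^sub>v x)) $ i"
      using index_add_vec(1) [OF dim [OF P]] by (rule arg_cong [THEN trans])
    moreover have "U *\<^sub>v e = U *\<^sub>v ((U\<^sup>T * U_hat) *\<^sub>v x) - U *\<^sub>v (W\<^sub>U *\<^sub>v x)"
      unfolding e_def by (rule mult_minus_distrib_mat_vec [OF D(1) UUx Wx])
    then have "(U *\<^sub>v e) $ i = (U *\<^sub>v ((U\<^sup>T * U_hat) *\<^sub>v x)) $ i - (U *\<^sub>v (W\<^sub>U *\<^sub>v x)) $ i"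
      using index_minus_vec(1) [OF dim [OF D(1)]] by (rule arg_cong [THEN trans])
    ultimately have "((U_hat - U * W\<^sub>U) *\<^sub>v x) $ i = (U *\<^sub>v e) $ i + (?P *\<^sub>v (U_hat *\<^sub>v x)) $ i"
      by linarith
    also have "(?P *\<^sub>v (U_hat *\<^sub>v x)) $ i
        = ((?P * X * ?Q') *\<^sub>v w) $ i + ((?P * E * ?Q) *\<^sub>v z) $ i + ((?P * E * ?Q') *\<^sub>v w) $ i"
      unfolding PUx PXQ
    proof -
      have "(0\<^sub>v p\<^sub>1 + a + (b + c)) $ i = a $ i + b $ i + c $ i"
        if "a \<in> carrier_vec p\<^sub>1" "b \<in> carrier_vec p\<^sub>1" "c \<in> carrier_vec p\<^sub>1" for a b c :: "real vec"
        using that i by simp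
      from this [OF mult_mat_vec_carrier [OF PXQ' w] mult_mat_vec_carrier [OF PEQ z]
          mult_mat_vec_carrier [OF PEQ' w]]
      show "(0\<^sub>v p\<^sub>1 + (?P * X * ?Q') *\<^sub>v w + ((?P * E * ?Q) *\<^sub>v z + (?P * E * ?Q') *\<^sub>v w)) $ i
          = ((?P * X * ?Q') *\<^sub>v w) $ i + ((?P * E * ?Q) *\<^sub>v z) $ i + ((?P * E * ?Q') *\<^sub>v w) $ i" .
    qed
    finally have "\<bar>((U_hat - U * W\<^sub>U) *\<^sub>v x) $ i\<bar> \<le> \<bar>(U *\<^sub>v e) $ i\<bar> + (\<bar>((?P * X * ?Q') *\<^sub>v w) $ i\<bar>
        + \<bar>((?P * E * ?Q) *\<^sub>v z) $ i\<bar> + \<bar>((?P * E * ?Q') *\<^sub>v w) $ i\<bar>)" by linarith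
    also have "\<dots> \<le> ?nU * ?sU\<^sup>2 + (?nX * (?sV * (2 / ?\<sigma>)) + ?nEV * (2 / ?\<sigma>) + ?nE * (?sV * (2 / ?\<sigma>)))"
    proof (intro add_mono)
      have bound: "\<bar>(A *\<^sub>v v) $ i\<bar> \<le> two_inf_norm A * c"
        if "A \<in> carrier_mat p\<^sub>1 n" "v \<in> carrier_vec n" "l2_norm_vec v \<le> c" "0 < n" for A v n c
        using abs_mult_mat_vec_index_le_two_inf_norm [OF that(1,2) i]
          mult_left_mono [OF that(3) two_inf_norm_nonneg [OF that(1) \<open>0 < p\<^sub>1\<close> that(4)]]
        by linarith
      show "\<bar>(U *\<^sub>v e) $ i\<bar> \<le> ?nU * ?sU\<^sup>2" by (rule bound [OF D(1) e ne \<open>0 < r\<close>])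
      show "\<bar>((?P * X * ?Q') *\<^sub>v w) $ i\<bar> \<le> ?nX * (?sV * (2 / ?\<sigma>))"
        by (rule bound [OF PXQ' w nw \<open>0 < p\<^sub>2\<close>])
      show "\<bar>((?P * E * ?Q) *\<^sub>v z) $ i\<bar> \<le> ?nEV * (2 / ?\<sigma>)"
        by (rule bound [OF PEQ z nz \<open>0 < p\<^sub>2\<close>])
      show "\<bar>((?P * E * ?Q') *\<^sub>v w) $ i\<bar> \<le> ?nE * (?sV * (2 / ?\<sigma>))"
        by (rule bound [OF PEQ' w nw \<open>0 < p\<^sub>2\<close>])
    qed
    also have "\<dots> = 2 * (?nEV / ?\<sigma>) + 2 * (?nE / ?\<sigma>) * ?sV + 2 * (?nX / ?\<sigma>) * ?sV + ?sU\<^sup>2 * ?nU"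
      by (simp add: algebra_simps)
    finally show "\<bar>((U_hat - U * W\<^sub>U) *\<^sub>v x) $ i\<bar>
      \<le> 2 * (?nEV / ?\<sigma>) + 2 * (?nE / ?\<sigma>) * ?sV + 2 * (?nX / ?\<sigma>) * ?sV + ?sU\<^sup>2 * ?nU" .
  qed
qed

end
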